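(* Let $\eta\in\{\mathbf{i},\mathbf{j},\mathbf{k}\}$, let $\mathcal{A}\in\mathbb{H}^{I_{1}\times \cdots \times I_{N}\times J_{1}\times \cdots \times J_{N}}$, $\mathcal{C}\in\mathbb{H}^{I_{1}\times \cdots \times I_{N}\times G_{1}\times \cdots \times G_{N}}$ and $\mathcal{E}=\mathcal{E}^{\eta*}\in\mathbb{H}^{I_{1}\times \cdots \times I_{N}\times I_{1}\times \cdots \times I_{N}}$. Set $$\mathcal{P}=\mathcal{R}_{\mathcal{A}}*_{N}\mathcal{C},\quad \mathcal{S}=\mathcal{C}*_{N}\mathcal{L}_{\mathcal{P}}.$$ Then the quaternion tensor equation $$\mathcal{A}*_{N}\mathcal{X}*_{N}\mathcal{A}^{\eta*}+\mathcal{C}*_{N}\mathcal{Y}*_{N}\mathcal{C}^{\eta*}=\mathcal{E},\quad \mathcal{X}=\mathcal{X}^{\eta*},\quad \mathcal{Y}=\mathcal{Y}^{\eta*},$$ in the unknowns $\mathcal{X}\in\mathbb{H}^{J_{1}\times \cdots \times J_{N}\times J_{1}\times \cdots \times J_{N}}$, $\mathcal{Y}\in\mathbb{H}^{G_{1}\times \cdots \times G_{N}\times G_{1}\times \cdots \times G_{N}}$ has a solution (an $\eta$-Hermitian solution) if and only if $$\mathcal{R}_{\mathcal{P}}*_{N}\mathcal{R}_{\mathcal{A}}*_{N}\mathcal{E}=0,\qquad \mathcal{R}_{\mathcal{A}}*_{N}\mathcal{E}*_{N}\mathcal{R}_{\mathcal{C}}=0.$$ In this case, the general $\eta$-Hermitian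 solution can be expressed as $$\mathcal{X}=\frac{\widehat{\mathcal{X}}+\widehat{\mathcal{X}}^{\eta*}}{2},\qquad \mathcal{Y}=\frac{\widehat{\mathcal{Y}}+\widehat{\mathcal{Y}}^{\eta*}}{2},$$ where $$\begin{aligned}\widehat{\mathcal{X}}=&\ \mathcal{A}^{\dag}*_{N}\mathcal{E}*_{N}(\mathcal{A}^{\dag})^{\eta*}-\mathcal{A}^{\dag}*_{N}\mathcal{C}*_{N}\mathcal{P}^{\dag}*_{N}\mathcal{E}*_{N}(\mathcal{A}^{\dag})^{\eta*}\\&-\mathcal{A}^{\dag}*_{N}\mathcal{S}*_{N}\mathcal{C}^{\dag}*_{N}\mathcal{E}*_{N}(\mathcal{P}^{\dag})^{\eta*}*_{N}\mathcal{C}^{*}*_{N}(\mathcal{A}^{\dag})^{\eta*}\\&-\mathcal{A}^{\dag}*_{N}\mathcal{S}*_{N}\mathcal{U}_{2}*_{N}\mathcal{L}_{\mathcal{P}}*_{N}\mathcal{C}^{\eta*}*_{N}(\mathcal{A}^{\dag})^{\eta*}+\mathcal{L}_{\mathcal{A}}*_{N}\mathcal{U}_{4}+\mathcal{U}_{5}*_{N}\mathcal{L}_{\mathcal{A}},\end{aligned}$$ $$\begin{aligned}\widehat{\mathcal{Y}}=&\ \mathcal{P}^{\dag}*_{N}\mathcal{E}*_{N}(\mathcal{C}^{\dag})^{\eta*}+\mathcal{S}^{\dag}*_{N}\mathcal{S}*_{N}\mathcal{C}^{\dag}*_{N}\mathcal{E}*_{N}(\mathcal{P}^{\dag})^{\eta*}\\&+\mathcal{L}_{\mathcal{P}}*_{N}\mathcal{L}_{\mathcal{S}}*_{N}\mathcal{U}_{1}+\mathcal{L}_{\mathcal{P}}*_{N}\mathcal{U}_{2}*_{N}\mathcal{L}_{\mathcal{P}}+\mathcal{U}_{3}*_{N}\mathcal{L}_{\mathcal{C}},\end{aligned}$$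 and $\mathcal{U}_{1},\mathcal{U}_{2},\mathcal{U}_{3},\mathcal{U}_{4},\mathcal{U}_{5}$ are arbitrary quaternion tensors with suitable order.
   Context: $\mathbb{H}$ is the real quaternion algebra $\{q_0+q_1\mathbf{i}+q_2\mathbf{j}+q_3\mathbf{k}: q_0,\ldots,q_3\in\mathbb{R}\}$ with $\mathbf{i}^2=\mathbf{j}^2=\mathbf{k}^2=\mathbf{ijk}=-1$, and $\bar q=q_0-q_1\mathbf{i}-q_2\mathbf{j}-q_3\mathbf{k}$. $\mathbb{H}^{I_1\times\cdots\times I_N}$ is the set of order $N$ arrays $(a_{i_1\cdots i_N})_{1\le i_j\le I_j}$ with quaternion entries. Einstein product: for $\mathcal{A}\in\mathbb{H}^{I_{1}\times \cdots \times I_{N}\times J_{1}\times \cdots \times J_{N}}$ and $\mathcal{B}\in\mathbb{H}^{J_{1}\times \cdots \times J_{N}\times K_{1}\times \cdots \times K_{M}}$, $(\mathcal{A}*_{N}\mathcal{B})_{i_{1}\cdots i_{N}k_{1}\cdots k_{M}}=\sum_{j_{1}\cdots j_{N}}a_{i_{1}\cdots i_{N}j_{1}\cdots j_{N}}b_{j_{1}\cdots j_{N}k_{1}\cdots k_{M}}$. This product is associative. Conjugate transpose: $(\mathcal{A}^* )_{j_1\cdots j_Ni_1\cdots i_N}=\overline{a_{i_1\cdots i_Nj_1\cdots j_N}}$. For $\eta\in\{\mathbf{i},\mathbf{j},\mathbf{k}\}$, $\mathcal{A}^{\eta*}=-\eta\mathcal{A}^*\eta$ (entrywise multiplication by $\eta$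 on both sides); a square tensor is $\eta$-Hermitian if $\mathcal{A}=\mathcal{A}^{\eta*}$. The unit tensor $\mathcal{I}$ has entry $1$ at positions $(i_1,\ldots,i_N,i_1,\ldots,i_N)$ and $0$ elsewhere. Moore-Penrose inverse: for $\mathcal{A}\in\mathbb{H}^{I_{1}\times \cdots \times I_{N}\times J_{1}\times \cdots \times J_{N}}$, $\mathcal{A}^{\dag}\in\mathbb{H}^{J_{1}\times \cdots \times J_{N}\times I_{1}\times \cdots \times I_{N}}$ is the (unique, existing) tensor $\mathcal{X}$ satisfying $\mathcal{A}*_{N}\mathcal{X}*_{N}\mathcal{A}=\mathcal{A}$, $\mathcal{X}*_{N}\mathcal{A}*_{N}\mathcal{X}=\mathcal{X}$, $(\mathcal{A}*_{N}\mathcal{X})^{*}=\mathcal{A}*_{N}\mathcal{X}$, $(\mathcal{X}*_{N}\mathcal{A})^{*}=\mathcal{X}*_{N}\mathcal{A}$. Notation: $\mathcal{L}_{\mathcal{A}}=\mathcal{I}-\mathcal{A}^{\dag}*_{N}\mathcal{A}$ and $\mathcal{R}_{\mathcal{A}}=\mathcal{I}-\mathcal{A}*_{N}\mathcal{A}^{\dag}$, with unit tensors of the appropriate size (and likewise for the other tensors used as subscripts). $0$ denotes the zero tensor.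
   Formalization: False as printed; corrected: R_C becomes (R_C)^{η*} in the second condition; in X̂, C^* becomes C^{η*}, L_P after U_2 becomes (L_P)^{η*}, and U_5 L_A becomes U_5 (L_A)^{η*}; in Ŷ, L_P after U_2 becomes (L_P)^{η*} and U_3 L_C becomes U_3 (L_C)^{η*}. *)

theory Defs
  imports "HOL-Analysis.Analysis" "HOL-Library.Function_Algebras"
begin

section \<open>The real quaternion algebra\<close>

datatype quat = Quat (re: real) (im1: real) (im2: real) (im3: real)

lemma quat_eq_iff:
  "p = q \<longleftrightarrow> re p = re q \<and> im1 p = im1 q \<and> im2 p = im2 q \<and> im3 p = im3 q"
  by (cases p; cases q) simp

instantiation quat :: real_algebra_1
begin

definition zero_quat :: quat where "0 = Quat 0 0 0 0"

definition one_quat :: quat where "1 = Quat 1 0 0 0"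

definition plus_quat :: "quat \<Rightarrow> quat \<Rightarrow> quat" where
  "p + q = Quat (re p + re q) (im1 p + im1 q) (im2 p + im2 q) (im3 p + im3 q)"

definition uminus_quat :: "quat \<Rightarrow> quat" where
  "- q = Quat (- re q) (- im1 q) (- im2 q) (- im3 q)"

definition minus_quat :: "quat \<Rightarrow> quat \<Rightarrow> quat" where
  "p - q = Quat (re p - re q) (im1 p - im1 q) (im2 p - im2 q) (im3 p - im3 q)"

definition times_quat :: "quat \<Rightarrow> quat \<Rightarrow> quat" where
  "p * q = Quat
     (re p * re q - im1 p * im1 q - im2 p * im2 q - im3 p * im3 q)
     (re p * im1 q + im1 p * re q + im2 p * im3 q - im3 p * im2 q)
     (re p * im2 q - im1 p * im3 q + im2 p * re q + im3 p * im1 q)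
     (re p * im3 q + im1 p * im2 q - im2 p * im1 q + im3 p * re q)"

definition scaleR_quat :: "real \<Rightarrow> quat \<Rightarrow> quat" where
  "r *\<^sub>R q = Quat (r * re q) (r * im1 q) (r * im2 q) (r * im3 q)"

instance
  by standard
    (simp_all add: zero_quat_def one_quat_def plus_quat_def uminus_quat_def minus_quat_def
      times_quat_def scaleR_quat_def quat_eq_iff algebra_simps)

end

definition quat_i :: quat ("\<i>\<^sub>q") where "\<i>\<^sub>q = Quat 0 1 0 0"
definition quat_j :: quat ("\<j>\<^sub>q") where "\<j>\<^sub>q = Quat 0 0 1 0"
definition quat_k :: quat ("\<k>\<^sub>q") where "\<k>\<^sub>q = Quat 0 0 0 1"

lemma quat_units:
  "\<i>\<^sub>q * \<i>\<^sub>q = - 1" "\<j>\<^sub>q * \<j>\<^sub>q = - 1" "\<k>\<^sub>q * \<k>\<^sub>q = - 1" "\<i>\<^sub>q * \<j>\<^sub>q * \<k>\<^sub>q = - 1"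
  by (simp_all add: quat_i_def quat_j_def quat_k_def times_quat_def one_quat_def uminus_quat_def)

definition quat_cnj :: "quat \<Rightarrow> quat" where
  "quat_cnj q = Quat (re q) (- im1 q) (- im2 q) (- im3 q)"

section \<open>Tensors\<close>

text \<open>
  An array of order \<open>n\<close> and size \<open>d\<^sub>1 \<times> \<dots> \<times> d\<^sub>n\<close> is a function on index lists of length \<open>n\<close>,
  indexed from \<open>0\<close>.  It is set to \<open>0\<close> off the index set, so that equality of tensors
  of the same size is equality of functions, and \<open>+\<close>, \<open>-\<close>, \<open>0\<close> are the pointwise operations.
  An array of size \<open>I\<^sub>1 \<times> \<dots> \<times> I\<^sub>N \<times> J\<^sub>1 \<times> \<dots> \<times> J\<^sub>N\<close> belongs to \<open>tensors (I @ J)\<close>.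
\<close>

type_synonym tensor = "nat list \<Rightarrow> quat"

definition indices :: "nat list \<Rightarrow> nat list set" where
  "indices ds = {xs. list_all2 (<) xs ds}"

definition tensors :: "nat list \<Rightarrow> tensor set" where
  "tensors ds = {T. \<forall>xs. xs \<notin> indices ds \<longrightarrow> T xs = 0}"

text \<open>
  The Einstein product, contracting the modes of size \<open>J\<close>, i.e. \<open>*\<^sub>N\<close> with \<open>N = length J\<close>.
  For \<open>A \<in> tensors (I @ J)\<close> with \<open>length I = N\<close> and \<open>B \<in> tensors (J @ K)\<close> it lies
  in \<open>tensors (I @ K)\<close>; the first \<open>N\<close> entries of an index of the product are the
  row modes of \<open>A\<close>.
\<close>

definition einstein :: "tensor \<Rightarrow> nat list \<Rightarrow> tensor \<Rightarrow> tensor"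
    ("(_ \<star>\<^bsub>_\<^esub>/ _)" [70, 0, 71] 70) where
  "A \<star>\<^bsub>J\<^esub> B = (\<lambda>xs. \<Sum>js\<in>indices J.
      A (take (length J) xs @ js) * B (js @ drop (length J) xs))"

definition unit_tensor :: "nat list \<Rightarrow> tensor" where
  "unit_tensor I = (\<lambda>xs. if \<exists>is\<in>indices I. xs = is @ is then 1 else 0)"

text \<open>
  Conjugate transpose of an array of order \<open>2N\<close>: here \<open>xs\<close> is \<open>js @ is\<close> with both
  halves of length \<open>N\<close>, and the entry is the conjugate of the entry at \<open>is @ js\<close>.
\<close>

definition ctranspose :: "nat \<Rightarrow> tensor \<Rightarrow> tensor" where
  "ctranspose N A = (\<lambda>xs. quat_cnj (A (drop N xs @ take N xs)))"

definition eta_star :: "quat \<Rightarrow> nat \<Rightarrow> tensor \<Rightarrow> tensor" where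
  "eta_star \<eta> N A = (\<lambda>xs. - (\<eta> * ctranspose N A xs * \<eta>))"

definition eta_hermitian :: "quat \<Rightarrow> nat \<Rightarrow> tensor \<Rightarrow> bool" where
  "eta_hermitian \<eta> N A \<longleftrightarrow> A = eta_star \<eta> N A"

definition half_tensor :: "tensor \<Rightarrow> tensor" where
  "half_tensor A = (\<lambda>xs. (1/2) *\<^sub>R A xs)"

text \<open>
  In the following, \<open>A \<in> tensors (I @ J)\<close> with \<open>length I = length J\<close>.
\<close>

definition is_mp_inverse :: "nat list \<Rightarrow> nat list \<Rightarrow> tensor \<Rightarrow> tensor \<Rightarrow> bool" where
  "is_mp_inverse I J A X \<longleftrightarrow>
     X \<in> tensors (J @ I) \<and>
     A \<star>\<^bsub>J\<^esub> X \<star>\<^bsub>I\<^esub> A = A \<and>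
     X \<star>\<^bsub>I\<^esub> A \<star>\<^bsub>J\<^esub> X = X \<and>
     ctranspose (length I) (A \<star>\<^bsub>J\<^esub> X) = A \<star>\<^bsub>J\<^esub> X \<and>
     ctranspose (length J) (X \<star>\<^bsub>I\<^esub> A) = X \<star>\<^bsub>I\<^esub> A"

definition mp_inverse :: "nat list \<Rightarrow> nat list \<Rightarrow> tensor \<Rightarrow> tensor" where
  "mp_inverse I J A = (THE X. is_mp_inverse I J A X)"

definition proj_L :: "nat list \<Rightarrow> nat list \<Rightarrow> tensor \<Rightarrow> tensor" where
  "proj_L I J A = unit_tensor J - mp_inverse I J A \<star>\<^bsub>I\<^esub> A"

definition proj_R :: "nat list \<Rightarrow> nat list \<Rightarrow> tensor \<Rightarrow> tensor" where
  "proj_R I J A = unit_tensor I - A \<star>\<^bsub>J\<^esub> mp_inverse I J A"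

definition eta_hermitian_solution ::
    "quat \<Rightarrow> nat list \<Rightarrow> nat list \<Rightarrow> nat list \<Rightarrow> tensor \<Rightarrow> tensor \<Rightarrow> tensor \<Rightarrow>
     tensor \<Rightarrow> tensor \<Rightarrow> bool" where
  "eta_hermitian_solution \<eta> I J G A C E X Y \<longleftrightarrow>
     X \<in> tensors (J @ J) \<and> Y \<in> tensors (G @ G) \<and>
     A \<star>\<^bsub>J\<^esub> X \<star>\<^bsub>J\<^esub> eta_star \<eta> (length I) A + C \<star>\<^bsub>G\<^esub> Y \<star>\<^bsub>G\<^esub> eta_star \<eta> (length I) C = E \<and>
     eta_hermitian \<eta> (length J) X \<and> eta_hermitian \<eta> (length G) Y"

end

(*
  Quaternion tensors of all sizes embed, as matrix blocks, into the single algebra of finitely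
  supported quaternion matrices indexed by lists, with the conjugate transpose and the
  eta-conjugate transpose as involutions; there the theorem is an identity-chasing argument.
  For a two-sided equation A X B + C Y D = E with B, D the eta-conjugates of A, C,
  the formulas solve the equation because S = C L_P is annihilated by R_A and P^dag absorbs R_A.
  Conversely a solution (X, Y) is recovered from U1 = Y, U2 = S^dag S Y, U3 = P^dag P Y,
  U4 = X B B^dag, U5 = X. As E is eta-Hermitian, solutions can be symmetrised.
  Moore-Penrose inverses exist since A^* A generates a finite-dimensional algebra and
  Z^* Z = 0 forces Z = 0.
*)
theory Submission
  imports Defs
begin

text \<open>Multiplying \<open>a * x * b + c * y * d = e\<close> by \<open>ra\<close> on the left,
  respectively by \<open>sig ra\<close> on the right, leaves two equations for \<open>y\<close>
  alone: \<open>p * y * d = ra * e\<close> and \<open>c * y * sig p = e * sig ra\<close>.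
  \<open>gen_y\<close> is built to solve both, and \<open>gen_x\<close> then solves
  \<open>a * x * b = e - c * y * d\<close>. The general two-sided equation has four solvability
  conditions; for \<eta>-Hermitian E, \<open>sig\<close> exchanges them in pairs, so two remain.
  Identities for right-hand factors are \<open>sig\<close>-images of left-hand ones. Hence the
  formal statement has \<eta>-conjugates at the right-hand projections, and at the factor that the
  English formula prints as C^*: on the left \<open>a * la = 0\<close>, but on the right it is
  \<open>sig la * b = 0\<close>, and \<open>sig la\<close> equals \<open>la\<close> only if
  \<open>la\<close> commutes with \<eta>. Index lists form an infinite set, so the finitely
  supported matrices have no unit. Unit tensors of fixed size take its place, and the cancellation
  arguments must do without 1.\<close>

section \<open>Moore-Penrose inverses in algebras with involution\<close>

text \<open>Otherwise, collecting terms backwards from the last index gives independent families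
  larger than \<open>card T\<close>. Later terms are wanted because, for powers, the lowest one then
  becomes a combination of higher ones and can be factored out.\<close>

lemma in_span_of_later_terms:
  fixes v :: "nat \<Rightarrow> 'a::real_vector"
  assumes T: "finite T" "range v \<subseteq> span T"
  shows "\<exists>m. v m \<in> span (v ` {m<..})"
proof (rule ccontr)
  assume "\<not> ?thesis"
  then have no: "v m \<notin> span (v ` {m<..})" for m by blast
  define n where "n = Suc (card T)"
  have "independent (v ` {n - k..<n}) \<and> card (v ` {n - k..<n}) = k" if "k \<le> n" for k
    using that
  proof (induction k)
    case (Suc k)
    define m where "m = n - Suc k"
    have split: "{n - Suc k..<n} = insert m {n - k..<n}"
      using Suc.prems by (auto simp: m_def)
    have "v ` {n - k..<n} \<subseteq> v ` {m<..}"
      using Suc.prems by (intro image_mono) (auto simp: m_def)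
    then have notin: "v m \<notin> span (v ` {n - k..<n})"
      using no[of m] span_mono by blast
    then have "v m \<notin> v ` {n - k..<n}"
      by (metis span_base)
    moreover have "independent (v ` {n - k..<n})" "card (v ` {n - k..<n}) = k"
      using Suc by auto
    ultimately show ?case
      using notin by (simp add: split independent_insertI)
  qed (simp add: independent_empty)
  from this[of n] have "independent (v ` {0..<n})" "card (v ` {0..<n}) = n" by simp_all
  moreover have "card (v ` {0..<n}) \<le> card T"
    using independent_span_bound[OF T(1) calculation(1)] T(2) by (meson image_mono order_trans subset_UNIV)
  ultimately show False by (simp add: n_def)
qed

text \<open>One notion serves four maps: conjugation and \<eta>-twisted conjugation of quaternions,
  and the two transposes that they induce on matrices.\<close>

locale involution =
  fixes star :: "'a::real_algebra \<Rightarrow> 'a"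
  assumes star_add: "star (x + y) = star x + star y"
    and star_mult: "star (x * y) = star y * star x"
    and star_star: "star (star x) = x"
    and star_scaleR: "star (r *\<^sub>R x) = r *\<^sub>R star x"
begin

lemma star_zero: "star 0 = 0"
  using star_scaleR[of 0 0] by simp

lemma star_minus: "star (- x) = - star x"
  using star_scaleR[of "- 1" x] by simp

lemma star_diff: "star (x - y) = star x - star y"
  using star_add[of x "- y"] by (simp add: star_minus)

lemmas star_simps = star_add star_mult star_star star_scaleR star_zero star_minus star_diff

definition is_mp :: "'a \<Rightarrow> 'a \<Rightarrow> bool" where
  "is_mp a x \<longleftrightarrow> a * x * a = a \<and> x * a * x = x \<and> star (a * x) = a * x \<and> star (x * a) = x * a"

text \<open>Applying \<open>star\<close> to \<open>(a * y) * (a * x) = a * x\<close> reverses the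
  two self-adjoint factors, and the reversed product is \<open>a * y\<close>. The same works for
  \<open>x * a\<close> and \<open>y * a\<close>.\<close>

lemma is_mp_unique:
  assumes "is_mp a x" "is_mp a y"
  shows "x = y"
proof -
  have ax: "a * x = a * y"
  proof -
    have "a * x = star (a * x)" using assms by (simp add: is_mp_def)
    also have "\<dots> = star ((a * y) * (a * x))" using assms by (simp add: is_mp_def flip: mult.assoc)
    also have "\<dots> = star (a * x) * star (a * y)" by (rule star_mult)
    also have "\<dots> = (a * x) * (a * y)" using assms by (simp add: is_mp_def)
    also have "\<dots> = a * y" using assms by (simp add: is_mp_def flip: mult.assoc)
    finally show ?thesis .
  qed
  have xa: "x * a = y * a"
  proof -
    have "x * a = star (x * a)" using assms by (simp add: is_mp_def)
    also have "\<dots> = star ((x * a) * (y * a))" using assms by (simp add: is_mp_def mult.assoc)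
    also have "\<dots> = star (y * a) * star (x * a)" by (rule star_mult)
    also have "\<dots> = (y * a) * (x * a)" using assms by (simp add: is_mp_def)
    also have "\<dots> = y * a" using assms by (simp add: is_mp_def mult.assoc)
    finally show ?thesis .
  qed
  have "x = x * a * x" using assms by (simp add: is_mp_def)
  also have "\<dots> = y * (a * x)" by (simp add: xa mult.assoc)
  also have "\<dots> = y" using assms by (simp add: ax is_mp_def mult.assoc)
  finally show ?thesis .
qed

text \<open>Since \<open>x = star a * star x * x\<close>, every left unit of \<open>star a\<close>
  is one of \<open>x\<close>. This gives both the size of a Moore-Penrose inverse and its absorption
  of projections.\<close>

lemma is_mp_absorb_left:
  assumes "is_mp a x" "u * star a = star a"
  shows "u * x = x"
proof -
  have x: "x = star a * star x * x"
    using assms(1) by (metis is_mp_def star_mult)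
  show ?thesis by (subst (1 2) x) (simp add: assms(2) flip: mult.assoc)
qed

lemma is_mp_absorb_right:
  assumes "is_mp a x" "star a * u = star a"
  shows "x * u = x"
proof -
  have x: "x = x * star x * star a"
    using assms(1) by (metis is_mp_def star_mult mult.assoc)
  show ?thesis by (subst (1 2) x) (simp add: assms(2) mult.assoc)
qed

end

locale proper_involution = involution +
  assumes proper: "star x * x = 0 \<Longrightarrow> x = 0"
begin

text \<open>
  With \<open>h = a\<^sup>* a\<close>, a linear relation between the odd powers of \<open>h\<close> reads
  \<open>h\<^sup>n h = h\<^sup>n h (h k)\<close> with a polynomial \<open>k\<close> in \<open>h\<close>. Properness cancels the factor
  \<open>h\<^sup>n\<close>, and then the generalised inverse of \<open>a\<close> is \<open>k a\<^sup>*\<close>.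
  Odd powers keep \<open>k\<close> without constant term, as there need not be a unit.
\<close>

lemma is_mp_exists:
  assumes T: "finite T" "\<And>n. ((*) (star a * a) ^^ n) (star a * a) \<in> span T"
  shows "\<exists>x. is_mp a x"
proof -
  define h where "h = star a * a"
  define p where "p n = ((*) h ^^ n) h" for n
  have star_h: "star h = h" by (simp add: h_def star_simps)
  have p_Suc: "p (Suc n) = h * p n" for n by (simp add: p_def)
  have p_comm: "p n * h = h * p n" for n
    by (induction n) (simp_all add: p_Suc mult.assoc, simp add: p_def)
  have p_star: "star (p n) = p n" for n
    by (induction n) (simp_all add: p_Suc star_mult star_h p_comm, simp add: p_def star_h)
  have p_add: "p (Suc (m + n)) = p m * p n" for m n
    by (induction m) (simp_all add: p_Suc mult.assoc, simp add: p_def)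

  \<comment> \<open>For z = x - y, \<open>h * (h * z) = 0\<close> makes
    \<open>star (h * z) * (h * z)\<close> vanish, and properness applies.\<close>
  have cancel_h: "h * x = h * y" if "h * (h * x) = h * (h * y)" for x y
  proof -
    have "star (h * (x - y)) * (h * (x - y)) = star (x - y) * (h * (h * (x - y)))"
      by (simp add: star_mult star_h mult.assoc)
    also have "\<dots> = 0" using that by (simp add: right_diff_distrib)
    finally show ?thesis using proper by (fastforce simp: right_diff_distrib)
  qed
  have cancel_p: "h * x = h * y" if "p n * x = p n * y" for n x y
    using that
  proof (induction n)
    case 0
    then show ?case by (simp add: p_def)
  next
    case (Suc n)
    have "h * (p n * x) = h * (p n * y)" using Suc.prems by (simp add: p_Suc mult.assoc)
    \<comment> \<open>\<open>cancel_h\<close> needs products that begin with \<open>h\<close>; every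
      \<open>p n\<close> does, as \<open>p 0 = h\<close>.\<close>
    moreover have "\<exists>z. \<forall>x. p n * x = h * (z x)"
      by (cases n) (auto simp: p_Suc mult.assoc, auto simp: p_def)
    ultimately show ?case using Suc.IH cancel_h by metis
  qed

  obtain m where m: "p (2 * m) \<in> span ((\<lambda>j. p (2 * j)) ` {m<..})"
    using in_span_of_later_terms[OF T(1), of "\<lambda>j. p (2 * j)"] T(2) by (auto simp: p_def h_def)
  \<comment> \<open>The multiples of \<open>p (2 * m)\<close> of the desired shape form a subspace,
    so a linear combination of higher terms is again given by a single \<open>k\<close>.\<close>
  define V where "V = {x. \<exists>k. h * k = k * h \<and> star k = k \<and> x = p (2 * m) * (h * k)}"
  have "subspace V"
  proof (rule subspaceI)
    show "0 \<in> V" by (auto simp: V_def star_zero intro!: exI[of _ 0])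
  next
    fix x y assume "x \<in> V" "y \<in> V"
    then obtain k l where "h * k = k * h" "star k = k" "x = p (2 * m) * (h * k)"
      "h * l = l * h" "star l = l" "y = p (2 * m) * (h * l)" by (auto simp: V_def)
    then show "x + y \<in> V"
      by (auto simp: V_def star_add algebra_simps intro!: exI[of _ "k + l"])
  next
    fix c x assume "x \<in> V"
    then obtain k where "h * k = k * h" "star k = k" "x = p (2 * m) * (h * k)"
      by (auto simp: V_def)
    then show "c *\<^sub>R x \<in> V"
      by (auto simp: V_def star_scaleR intro!: exI[of _ "c *\<^sub>R k"])
  qed
  moreover have "p (2 * j) \<in> V" if "m < j" for j
  proof -
    \<comment> \<open>\<open>p n\<close> is the power n + 1 of \<open>h\<close>, and the exponents
      match: (2m + 1) + 1 + (i + 1) = 2j + 1.\<close>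
    define i where "i = 2 * (j - m - 1)"
    have "2 * j = Suc (2 * m + Suc i)" using that by (simp add: i_def)
    then have "p (2 * j) = p (2 * m) * (h * p i)" using p_add[of "2 * m" "Suc i"] by (simp add: p_Suc)
    then show ?thesis unfolding V_def by (auto intro!: exI[of _ "p i"] simp: p_comm p_star)
  qed
  ultimately have "span ((\<lambda>j. p (2 * j)) ` {m<..}) \<subseteq> V"
    by (intro span_minimal) blast+
  with m obtain k where k: "h * k = k * h" "star k = k" "p (2 * m) = p (2 * m) * (h * k)"
    unfolding V_def by blast
  have "p (2 * m) * (h * k * h) = p (2 * m) * h"
    using k(3) by (metis mult.assoc)
  then have hhkh: "h * (h * k * h) = h * h" by (rule cancel_p)
  \<comment> \<open>\<open>cancel_h\<close> cannot strip the last factor from \<open>hhkh\<close>,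
    since that would require writing \<open>h\<close> as \<open>h * 1\<close>. The difference
    \<open>w\<close> is self-adjoint with \<open>h * w = 0\<close>, so properness is applied to
    \<open>w\<close> itself.\<close>
  have hkh: "h * k * h = h"
  proof -
    define w where "w = h * k * h - h"
    have w: "star w = w" by (simp add: w_def star_simps star_h k(2) mult.assoc)
    have "star w * w = (h * k) * (h * w) - h * w"
      unfolding w by (subst (1) w_def) (simp add: left_diff_distrib mult.assoc)
    also have "h * w = 0" using hhkh by (simp add: w_def right_diff_distrib)
    finally have "star w * w = 0" by simp
    then have "w = 0" by (rule proper)
    then show ?thesis by (simp add: w_def)
  qed
  have aka: "a * k * star a * a = a"
  proof -
    define w where "w = a * k * h - a"
    have "star w = h * k * star a - star a"
      by (simp add: w_def star_simps star_h k(2) mult.assoc)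
    then have "star w * w = (h * k) * (star a * w) - star a * w"
      by (simp add: left_diff_distrib mult.assoc)
    also have "star a * w = h * k * h - h"
      by (simp add: w_def h_def right_diff_distrib mult.assoc)
    finally have "star w * w = 0" using hkh by simp
    then have "w = 0" by (rule proper)
    then show ?thesis by (simp add: w_def h_def mult.assoc)
  qed
  define x where "x = k * star a"
  have axa: "a * x * a = a" using aka by (simp add: x_def mult.assoc)
  have ax: "star (a * x) = a * x" by (simp add: x_def star_simps k(2) mult.assoc)
  have "x * a = k * h" by (simp add: x_def h_def mult.assoc)
  then have xa: "star (x * a) = x * a" using k(1,2) by (simp add: star_simps star_h)
  \<comment> \<open>\<open>x\<close> satisfies every Moore-Penrose axiom except possibly
    \<open>x * a * x = x\<close>; replacing it by \<open>x * a * x\<close> gains this one and keeps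
    the others.\<close>
  have "a * (x * a * x) = (a * x * a) * x" "(x * a * x) * a = x * (a * x * a)"
    "(x * a) * (x * a * x) = x * (a * x * a) * x"
    by (simp_all only: mult.assoc)
  then have 1: "a * (x * a * x) = a * x" "x * a * x * a = x * a"
    "(x * a) * (x * a * x) = x * a * x"
    by (simp_all only: axa)
  have "is_mp a (x * a * x)"
    unfolding is_mp_def 1 axa ax xa by simp
  then show ?thesis ..
qed

end

section \<open>The two-term equation in an algebra with two involutions\<close>

text \<open>
  The tensor equation inside one algebra without unit: \<open>eI\<close>, \<open>eJ\<close>, \<open>eG\<close> are the unit tensors of the
  three sizes, and being a tensor of size \<open>I \<times> J\<close> becomes \<open>eI * x = x\<close>, \<open>x * eJ = x\<close>.
  A suffix \<open>d\<close> marks a Moore-Penrose inverse, the prefixes \<open>l\<close> and \<open>r\<close> are the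
  projections \<open>\<L>\<close> and \<open>\<R>\<close>, and \<open>sig\<close> is \<open>x \<mapsto> x\<^sup>\<eta>\<^sup>*\<close>.
\<close>

locale hermitian_equation =
  adj: involution adj + sig: involution sig
  for adj sig :: "'a::real_algebra \<Rightarrow> 'a" +
  fixes eI eJ eG a c e ad cd p pd s sd la ra lc rc lp rp ls :: 'a
  assumes adj_eI: "adj eI = eI" and adj_eJ: "adj eJ = eJ" and adj_eG: "adj eG = eG"
    and sig_eI: "sig eI = eI" and sig_eJ: "sig eJ = eJ" and sig_eG: "sig eG = eG"
    and eI_eI: "eI * eI = eI" and eJ_eJ: "eJ * eJ = eJ" and eG_eG: "eG * eG = eG"
    and eI_a: "eI * a = a" and a_eJ: "a * eJ = a"
    and eI_c: "eI * c = c" and c_eG: "c * eG = c"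
    and eI_e: "eI * e = e" and e_eI: "e * eI = e"
    and sig_e: "sig e = e"
    and p_eq: "p = ra * c" and s_eq: "s = c * lp"
    and mp_a: "adj.is_mp a ad" and mp_c: "adj.is_mp c cd"
    and mp_p: "adj.is_mp p pd" and mp_s: "adj.is_mp s sd"
    and la_eq: "la = eJ - ad * a" and ra_eq: "ra = eI - a * ad"
    and lc_eq: "lc = eG - cd * c" and rc_eq: "rc = eI - c * cd"
    and lp_eq: "lp = eG - pd * p" and rp_eq: "rp = eI - p * pd"
    and ls_eq: "ls = eG - sd * s"
begin

section \<open>Rules for the projections and generalised inverses\<close>

abbreviation "b \<equiv> sig a"
abbreviation "d \<equiv> sig c"

definition solves :: "'a \<Rightarrow> 'a \<Rightarrow> bool" where
  "solves x y \<longleftrightarrow> eJ * x = x \<and> x * eJ = x \<and> eG * y = y \<and> y * eG = y \<and> a * x * b + c * y * d = e"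

text \<open>Under the solvability conditions this is \<open>ad * (e - c * y * d) * sig ad\<close>
  with \<open>y = gen_y u1 u2 u3\<close>, plus two terms that vanish between \<open>a\<close> and
  \<open>b\<close>. The factor \<open>sig cd * d\<close> is missing after \<open>pd * e\<close>
  because the conditions make it act trivially there.\<close>

definition gen_x :: "'a \<Rightarrow> 'a \<Rightarrow> 'a \<Rightarrow> 'a" where
  "gen_x u2 u4 u5 = ad * e * sig ad - ad * c * pd * e * sig ad
     - ad * s * cd * e * sig pd * d * sig ad
     - ad * s * u2 * sig lp * d * sig ad + la * u4 + u5 * sig la"

text \<open>The first two terms are the particular part. The three parameter terms are annihilated
  by both y |-> \<open>p * y * d\<close> and y |-> \<open>c * y * sig p\<close>.\<close>

definition gen_y :: "'a \<Rightarrow> 'a \<Rightarrow> 'a \<Rightarrow> 'a" where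
  "gen_y u1 u2 u3 = pd * e * sig cd + sd * s * cd * e * sig pd
     + lp * ls * u1 + lp * u2 * sig lp + u3 * sig lc"

lemma mp_rules:
  "a * ad * a = a" "ad * a * ad = ad" "adj ad * adj a = a * ad" "adj a * adj ad = ad * a"
  "c * cd * c = c" "cd * c * cd = cd" "adj cd * adj c = c * cd" "adj c * adj cd = cd * c"
  "p * pd * p = p" "pd * p * pd = pd" "adj pd * adj p = p * pd" "adj p * adj pd = pd * p"
  "s * sd * s = s" "sd * s * sd = sd" "adj sd * adj s = s * sd" "adj s * adj sd = sd * s"
  using mp_a mp_c mp_p mp_s by (simp_all add: adj.is_mp_def adj.star_mult)

lemma adj_ra: "adj ra = ra" and adj_lp: "adj lp = lp"
  by (simp_all add: ra_eq lp_eq adj.star_simps adj_eI adj_eG mp_rules)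

lemma units:
  "eI * p = p" "p * eG = p" "eI * s = s" "s * eG = s"
  "eJ * ad = ad" "ad * eI = ad" "eG * cd = cd" "cd * eI = cd"
  "eG * pd = pd" "pd * eI = pd" "eG * sd = sd" "sd * eI = sd"
proof -
  show ep: "eI * p = p"
    by (simp add: p_eq ra_eq left_diff_distrib right_diff_distrib eI_c eI_eI eI_a flip: mult.assoc)
  show pe: "p * eG = p"
    by (simp add: p_eq c_eG mult.assoc)
  show es: "eI * s = s"
    by (simp add: s_eq eI_c flip: mult.assoc)
  show se: "s * eG = s"
    by (simp add: s_eq lp_eq left_diff_distrib right_diff_distrib mult.assoc eG_eG pe)
  have adj_unit: "adj y * adj x = adj z" if "x * y = z" for x y z
    using that by (metis adj.star_mult)
  note u = adj_unit[OF a_eJ, unfolded adj_eJ] adj_unit[OF eI_a, unfolded adj_eI]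
    adj_unit[OF c_eG, unfolded adj_eG] adj_unit[OF eI_c, unfolded adj_eI]
    adj_unit[OF pe, unfolded adj_eG] adj_unit[OF ep, unfolded adj_eI]
    adj_unit[OF se, unfolded adj_eG] adj_unit[OF es, unfolded adj_eI]
  \<comment> \<open>The sizes of the generalised inverses are inherited from the adjoints through
    the absorption lemmas.\<close>
  show "eJ * ad = ad" "ad * eI = ad"
    by (rule adj.is_mp_absorb_left[OF mp_a u(1)], rule adj.is_mp_absorb_right[OF mp_a u(2)])
  show "eG * cd = cd" "cd * eI = cd"
    by (rule adj.is_mp_absorb_left[OF mp_c u(3)], rule adj.is_mp_absorb_right[OF mp_c u(4)])
  show "eG * pd = pd" "pd * eI = pd"
    by (rule adj.is_mp_absorb_left[OF mp_p u(5)], rule adj.is_mp_absorb_right[OF mp_p u(6)])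
  show "eG * sd = sd" "sd * eI = sd"
    by (rule adj.is_mp_absorb_left[OF mp_s u(7)], rule adj.is_mp_absorb_right[OF mp_s u(8)])
qed

lemma proj_rules:
  "ra * a = 0" "a * la = 0" "c * lc = 0" "p * lp = 0" "rp * p = 0" "s * ls = 0" "rc * c = 0"
  "ad * ra = 0" "lp * pd = 0"
  by (simp_all add: ra_eq la_eq lc_eq lp_eq rp_eq ls_eq rc_eq left_diff_distrib right_diff_distrib
      units mp_rules eI_a a_eJ eI_c c_eG flip: mult.assoc)

lemma idem: "ra * ra = ra" "lp * lp = lp"
proof -
  have "ra * ra = eI * ra - a * (ad * ra)"
    by (subst (1) ra_eq) (simp add: left_diff_distrib mult.assoc)
  also have "\<dots> = ra"
    by (simp add: proj_rules) (simp add: ra_eq right_diff_distrib eI_eI eI_a flip: mult.assoc)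
  finally show "ra * ra = ra" .
  have "lp * lp = lp * eG - lp * pd * p"
    by (subst (2) lp_eq) (simp add: right_diff_distrib mult.assoc)
  also have "\<dots> = lp"
    by (simp add: proj_rules) (simp add: lp_eq left_diff_distrib eG_eG units mult.assoc)
  finally show "lp * lp = lp" .
qed

text \<open>\<open>adj p\<close> ends in the idempotent \<open>ra\<close> and \<open>adj s\<close>
  begins with the idempotent \<open>lp\<close>; the generalised inverses inherit this.\<close>

lemma absorb: "pd * ra = pd" "lp * sd = sd"
proof -
  have "adj p = adj c * ra" by (simp add: p_eq adj.star_mult adj_ra)
  then show "pd * ra = pd"
    by (intro adj.is_mp_absorb_right[OF mp_p]) (simp add: mult.assoc idem)
  have "adj s = lp * adj c" by (simp add: s_eq adj.star_mult adj_lp)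
  then show "lp * sd = sd"
    by (intro adj.is_mp_absorb_left[OF mp_s]) (simp add: idem flip: mult.assoc)
qed

lemma c_lp: "c * lp = s" and ra_c: "ra * c = p"
  by (simp_all add: s_eq p_eq)

text \<open>Behind these rules is the splitting of \<open>c\<close> into \<open>s\<close> and
  \<open>c * pd * p\<close>: as \<open>ra * s = p * lp = 0\<close>, the part \<open>s\<close> is
  reproduced by \<open>a * ad\<close>, while the other part is controlled by
  \<open>p\<close>.\<close>

lemma derived_rules:
  "pd * c = pd * p" "pd * a = 0" "ra * s = 0" "a * ad * s = s"
  "c * sd = s * sd" "p * cd * c = p" "s * cd * c = s" "lp * ls = lp - sd * s"
  "a * ad * c = c - p" "lp * sd * s = sd * s" "c * pd * p = c - s"
proof -
  show "pd * c = pd * p" by (metis absorb(1) mult.assoc ra_c)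
  show "pd * a = 0" by (metis absorb(1) mult.assoc proj_rules(1) mult_zero_right)
  show rs: "ra * s = 0" by (metis mult.assoc p_eq proj_rules(4) s_eq)
  have ra: "a * ad = eI - ra" by (simp add: ra_eq)
  show "a * ad * s = s" by (simp add: ra left_diff_distrib units rs)
  show "a * ad * c = c - p" by (simp add: ra left_diff_distrib eI_c ra_c)
  show "c * sd = s * sd" by (metis absorb(2) mult.assoc s_eq)
  show pcc: "p * cd * c = p" by (simp add: p_eq mult.assoc) (simp add: mp_rules flip: mult.assoc)
  show cpp: "c * pd * p = c - s"
    by (simp add: s_eq lp_eq right_diff_distrib c_eG mult.assoc)
  have "s * cd * c = c * cd * c - c * pd * (p * cd * c)"
    by (simp add: s_eq lp_eq right_diff_distrib left_diff_distrib c_eG mult.assoc)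
  then show "s * cd * c = s" by (simp only: pcc cpp mp_rules) simp
  show "lp * ls = lp - sd * s"
    by (simp add: ls_eq right_diff_distrib absorb flip: mult.assoc)
       (simp add: lp_eq left_diff_distrib mult.assoc eG_eG units)
  show "lp * sd * s = sd * s" by (simp add: absorb)
qed

text \<open>\<open>ra\<close> removes the \<open>x\<close>-term, then \<open>rp\<close> removes
  \<open>p\<close>, and \<open>sig rc\<close> removes \<open>d\<close> because
  \<open>d * sig rc = sig (rc * c)\<close>.\<close>

lemma necessary:
  assumes "solves x y"
  shows "rp * ra * e = 0" "ra * e * sig rc = 0"
proof -
  have e: "e = a * x * b + c * y * d" using assms by (simp add: solves_def)
  have ra_e: "ra * e = p * y * d"
    by (simp add: e distrib_left proj_rules ra_c flip: mult.assoc)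
  show "rp * ra * e = 0"
    by (simp add: mult.assoc ra_e) (simp add: proj_rules flip: mult.assoc)
  have "ra * e * sig rc = p * y * sig (rc * c)"
    by (simp add: ra_e sig.star_mult mult.assoc)
  then show "ra * e * sig rc = 0"
    by (simp add: proj_rules sig.star_zero)
qed

lemma general_solution:
  assumes cond: "rp * ra * e = 0" "ra * e * sig rc = 0"
  shows "a * gen_x u2 u4 u5 * b + c * gen_y u1 u2 u3 * d = e"
proof -
  \<comment> \<open>This is the \<open>sig\<close>-image of
    \<open>a * ad * c = c - p\<close>.\<close>
  have cad: "d * sig ad * b = d - sig p"
    using arg_cong[OF derived_rules(9), of sig] by (simp add: sig.star_simps mult.assoc)
  have t1: "d * (sig ad * b) = d - sig p" using cad by (simp add: mult.assoc)
  have t2: "sig lp * sig p = 0" using arg_cong[OF proj_rules(4), of sig] by (simp add: sig.star_simps)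
  have t3: "sig la * b = 0" using arg_cong[OF proj_rules(2), of sig] by (simp add: sig.star_simps)
  have t4: "sig lc * d = 0" using arg_cong[OF proj_rules(3), of sig] by (simp add: sig.star_simps)
  have ax: "a * gen_x u2 u4 u5 * b = a * ad * e * sig ad * b - a * ad * c * pd * e * sig ad * b
      - s * cd * e * sig pd * (d - sig p) - s * u2 * sig lp * d"
  proof -
    have "a * gen_x u2 u4 u5 * b = a * ad * e * sig ad * b - a * ad * c * pd * e * sig ad * b
      - (a * ad * s) * cd * e * sig pd * (d * (sig ad * b))
      - (a * ad * s) * u2 * (sig lp * (d * (sig ad * b))) + (a * la) * u4 * b + a * u5 * (sig la * b)"
      by (simp add: gen_x_def algebra_simps)
    then show ?thesis
      by (simp only: derived_rules(4) proj_rules(2) t1 t3)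
         (simp add: t2 right_diff_distrib mult.assoc)
  qed
  have cy: "c * gen_y u1 u2 u3 * d = c * pd * e * sig cd * d + s * cd * e * sig pd * d + s * u2 * sig lp * d"
  proof -
    have "c * gen_y u1 u2 u3 * d = c * pd * e * sig cd * d + (c * sd) * s * cd * e * sig pd * d
      + ((c * lp) * ls) * u1 * d + (c * lp) * u2 * sig lp * d + c * u3 * (sig lc * d)"
      by (simp add: gen_y_def algebra_simps)
    then show ?thesis
      by (simp add: t4 c_lp derived_rules proj_rules mp_rules)
  qed
  have ra_e: "p * pd * e = ra * e"
  proof -
    have "0 = eI * ra * e - p * (pd * ra) * e"
      using cond(1) by (simp add: rp_eq left_diff_distrib mult.assoc)
    moreover have "eI * ra = ra"
      by (simp add: ra_eq right_diff_distrib eI_eI eI_a flip: mult.assoc)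
    ultimately show ?thesis by (simp add: absorb)
  qed
  then have e_ra: "e * (sig pd * sig p) = e * sig ra"
    by (metis sig.star_mult sig_e mult.assoc)
  have e_rc: "pd * e * sig rc = 0"
  proof -
    have "pd * e * sig rc = pd * (ra * e * sig rc)"
      by (simp add: absorb flip: mult.assoc)
    then show ?thesis by (simp add: cond)
  qed
  have pd_e: "pd * e * sig cd * d = pd * e"
  proof -
    have "sig rc = eI - sig cd * d" by (simp add: rc_eq sig.star_simps sig_eI)
    then have "pd * e * sig rc = pd * e - pd * e * sig cd * d"
      by (simp add: right_diff_distrib mult.assoc e_eI)
    then show ?thesis using e_rc by simp
  qed
  \<comment> \<open>The \<open>sig\<close>-image of the second condition; that \<open>e\<close> is
    \<eta>-Hermitian enters here and in \<open>e_ra\<close>.\<close>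
  have rc_e: "c * cd * e * sig ra = e * sig ra"
  proof -
    have "rc * e * sig ra = sig (ra * e * sig rc)" by (simp add: sig.star_simps sig_e mult.assoc)
    then have "rc * e * sig ra = 0" by (simp add: cond sig.star_zero)
    then show ?thesis by (simp add: rc_eq left_diff_distrib eI_e)
  qed
  have s_e: "s * cd * e * sig ra = e * sig ra - c * pd * e * sig ra"
  proof -
    have "s = c - c * pd * c" using derived_rules by (simp add: mult.assoc)
    then have "s * cd * e * sig ra = c * cd * e * sig ra - c * pd * (c * cd * e * sig ra)"
      by (simp add: left_diff_distrib mult.assoc)
    then show ?thesis by (simp only: rc_e) (simp add: mult.assoc)
  qed
  have ad_b: "x * sig ad * b = x * eI - x * sig ra" for x
    by (simp add: ra_eq sig.star_simps sig_eI right_diff_distrib mult.assoc)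
  have a_ad: "a * ad * e = e - ra * e"
    by (simp add: ra_eq left_diff_distrib eI_e)
  have scd: "s * cd * e * sig pd * sig p = e * sig ra - c * pd * e * sig ra"
    using s_e e_ra by (simp add: mult.assoc)
  \<comment> \<open>The \<open>u2\<close> terms of \<open>ax\<close> and \<open>cy\<close> cancel,
    and so do the \<open>d\<close> parts of the terms with \<open>sig pd\<close>; only the
    \<open>sig p\<close> part survives.\<close>
  have "a * gen_x u2 u4 u5 * b + c * gen_y u1 u2 u3 * d
    = a * ad * e * sig ad * b - a * ad * c * pd * e * sig ad * b + s * cd * e * sig pd * sig p + c * (pd * e * sig cd * d)"
    unfolding ax cy by (simp add: right_diff_distrib mult.assoc)
  also have "\<dots> = a * ad * e * eI - a * ad * e * sig ra - (c - p) * pd * e * eI + (c - p) * pd * e * sig ra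
     + (e * sig ra - c * pd * e * sig ra) + c * (pd * e)"
    by (simp only: ad_b scd pd_e derived_rules(9)) simp
  also have "\<dots> = e"
    by (simp add: left_diff_distrib a_ad ra_e) (simp add: mult.assoc e_eI left_diff_distrib)
  finally show ?thesis .
qed

text \<open>Each parameter returns what a projection took away: \<open>pd * e\<close> is
  \<open>pd * p * y * d\<close>, so the \<open>u3\<close> term completes it to
  \<open>pd * p * y\<close>; the \<open>u2\<close> term likewise completes the second term to
  \<open>sd * s * y\<close>; the \<open>u1\<close> term adds \<open>lp * y - sd * s * y\<close>. The
  sum is \<open>y\<close>. For \<open>x\<close>, the bracket between \<open>ad\<close> and
  \<open>sig ad\<close> collapses to \<open>a * x * b\<close>.\<close>

lemma solution_is_general:
  assumes "solves x y"
  shows "gen_x (sd * s * y) (x * b * sig ad) x = x" (is ?X)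
    and "gen_y y (sd * s * y) (pd * p * y) = y" (is ?Y)
proof -
  have e: "e = a * x * b + c * y * d"
    and x: "eJ * x = x" "x * eJ = x" and y: "eG * y = y" "y * eG = y"
    using assms by (simp_all add: solves_def)
  have pde: "pd * e = pd * p * y * d"
    by (simp add: e distrib_left derived_rules flip: mult.assoc)
  have b_pd: "b * sig pd = 0"
    using arg_cong[OF derived_rules(2), of sig] by (simp add: sig.star_simps)
  have d_pd: "d * sig pd = sig p * sig pd"
    using arg_cong[OF derived_rules(1), of sig] by (simp add: sig.star_simps)
  have e_pd: "e * sig pd = c * y * sig p * sig pd"
    by (simp add: e distrib_right mult.assoc b_pd d_pd)
  have scep: "s * cd * e * sig pd = s * y * sig p * sig pd"
    using e_pd derived_rules by (metis mult.assoc)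
  have lp: "sig lp = eG - sig p * sig pd"
    by (simp add: lp_eq sig.star_simps sig_eG)
  have lc: "sig lc = eG - d * sig cd"
    by (simp add: lc_eq sig.star_simps sig_eG)
  have la: "sig la = eJ - b * sig ad"
    by (simp add: la_eq sig.star_simps sig_eJ)
  have sdss: "s * sd * s = s" by (simp add: mp_rules)
  have "gen_y y (sd * s * y) (pd * p * y) = pd * p * y * d * sig cd + sd * (s * cd * e * sig pd)
     + (lp * ls) * y + (lp * sd * s) * y * sig lp + pd * p * y * sig lc"
    by (simp add: gen_y_def pde mult.assoc)
  also have "\<dots> = pd * p * y * d * sig cd + sd * s * y * sig p * sig pd
     + (lp * y - sd * s * y) + sd * s * (y * eG - y * sig p * sig pd) + pd * p * (y * eG - y * d * sig cd)"
    by (simp only: scep derived_rules lp lc) (simp add: algebra_simps)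
  also have "\<dots> = pd * p * y + lp * y"
    by (simp add: y algebra_simps)
  also have "\<dots> = y"
    by (simp add: lp_eq left_diff_distrib y)
  finally show ?Y .
  have "gen_x (sd * s * y) (x * b * sig ad) x = ad * (e - c * (pd * e) - s * cd * e * sig pd * d
     - (s * sd * s) * y * sig lp * d) * sig ad + la * x * b * sig ad + x * sig la"
    by (simp add: gen_x_def algebra_simps)
  also have "\<dots> = ad * (e - c * (pd * e) - s * y * sig p * sig pd * d - s * y * sig lp * d) * sig ad
     + la * x * b * sig ad + x * sig la"
    by (simp only: scep sdss)
  also have "s * y * sig lp * d = s * y * d - s * y * sig p * sig pd * d"
    by (simp add: lp algebra_simps) (simp add: y flip: mult.assoc)
  also have "e - c * (pd * e) - s * y * sig p * sig pd * d - \<dots> = a * x * b + (c - c * pd * p - s) * y * d"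
    by (subst e) (simp add: pde left_diff_distrib mult.assoc)
  also have "\<dots> = a * x * b" by (simp add: derived_rules)
  also have "ad * (a * x * b) * sig ad + la * x * b * sig ad + x * sig la = x"
    unfolding la by (simp add: la_eq left_diff_distrib right_diff_distrib x flip: mult.assoc)
  finally show ?X by (simp only: mult.assoc)
qed

section \<open>Symmetrising solutions\<close>

abbreviation symm :: "'a \<Rightarrow> 'a" where
  "symm x \<equiv> (1/2) *\<^sub>R (x + sig x)"

lemma sig_symm: "sig (symm x) = symm x"
  by (simp add: sig.star_simps add.commute)

lemma symm_fixed: "sig x = x \<Longrightarrow> symm x = x"
  by (simp flip: scaleR_2)

text \<open>\<open>sig\<close> maps \<open>a * x * b\<close> to \<open>a * sig x * b\<close>, so it
  carries the equation to itself with \<open>sig x\<close>, \<open>sig y\<close> as unknowns; the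
  average of two solutions is a solution.\<close>

lemma symm_solution:
  assumes "a * x * b + c * y * d = e"
  shows "a * symm x * b + c * symm y * d = e"
proof -
  have "a * sig x * b + c * sig y * d = e"
    using arg_cong[OF assms, of sig] by (simp add: sig.star_simps sig_e mult.assoc)
  moreover have "a * symm x * b + c * symm y * d
    = (1/2) *\<^sub>R ((a * x * b + c * y * d) + (a * sig x * b + c * sig y * d))"
    by (simp add: algebra_simps scaleR_add_right)
  ultimately show ?thesis using assms by (simp flip: scaleR_2)
qed

end

section \<open>Finitely supported quaternion matrices\<close>

lemma quat_sel [simp]:
  "re 0 = 0" "im1 0 = 0" "im2 0 = 0" "im3 0 = 0"
  "re (p + q) = re p + re q" "im1 (p + q) = im1 p + im1 q"
  "im2 (p + q) = im2 p + im2 q" "im3 (p + q) = im3 p + im3 q"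
  "re (r *\<^sub>R q) = r * re q" "im1 (r *\<^sub>R q) = r * im1 q"
  "im2 (r *\<^sub>R q) = r * im2 q" "im3 (r *\<^sub>R q) = r * im3 q"
  by (simp_all add: zero_quat_def plus_quat_def scaleR_quat_def)

lemma re_sum: "re (sum f A) = (\<Sum>x\<in>A. re (f x))"
  by (induction A rule: infinite_finite_induct) simp_all

lemma quat_expand: "q = re q *\<^sub>R 1 + im1 q *\<^sub>R \<i>\<^sub>q + im2 q *\<^sub>R \<j>\<^sub>q + im3 q *\<^sub>R \<k>\<^sub>q"
  by (simp add: quat_eq_iff one_quat_def quat_i_def quat_j_def quat_k_def)

lemma re_cnj_mult: "re (quat_cnj q * q) = (re q)\<^sup>2 + (im1 q)\<^sup>2 + (im2 q)\<^sup>2 + (im3 q)\<^sup>2"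
  by (simp add: quat_cnj_def times_quat_def power2_eq_square)

lemma involution_quat_cnj: "involution quat_cnj"
  by standard (simp_all add: quat_cnj_def times_quat_def plus_quat_def scaleR_quat_def algebra_simps)

lemma involution_eta:
  assumes "\<eta> \<in> {\<i>\<^sub>q, \<j>\<^sub>q, \<k>\<^sub>q}"
  shows "involution (\<lambda>q. - (\<eta> * quat_cnj q * \<eta>))"
  using assms
  by (intro involution.intro)
    (auto simp: quat_cnj_def times_quat_def plus_quat_def uminus_quat_def scaleR_quat_def
      quat_i_def quat_j_def quat_k_def algebra_simps)

typedef 'i qmat =
  "{f :: 'i \<Rightarrow> 'i \<Rightarrow> quat. \<exists>B. finite B \<and> (\<forall>i j. f i j \<noteq> 0 \<longrightarrow> i \<in> B \<and> j \<in> B)}"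
  morphisms entry Abs_qmat
  by (rule exI[of _ "\<lambda>_ _. 0"]) auto

setup_lifting type_definition_qmat

lemma qmat_eqI: "(\<And>i j. entry x i j = entry y i j) \<Longrightarrow> x = y"
  by transfer blast

definition supported :: "'i set \<Rightarrow> 'i qmat \<Rightarrow> bool" where
  "supported B x \<longleftrightarrow> (\<forall>i j. entry x i j \<noteq> 0 \<longrightarrow> i \<in> B \<and> j \<in> B)"

lemma supported_ex: "\<exists>B. finite B \<and> supported B x"
  unfolding supported_def by transfer blast

lemma supported_mono: "supported B x \<Longrightarrow> B \<subseteq> C \<Longrightarrow> supported C x"
  by (auto simp: supported_def)

lemma supported2_ex: "\<exists>B. finite B \<and> supported B x \<and> supported B y"
proof -
  obtain B C where "finite B" "supported B x" "finite C" "supported C y"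
    using supported_ex by metis
  then show ?thesis by (intro exI[of _ "B \<union> C"]) (auto intro: supported_mono)
qed

section \<open>The algebra structure on finitely supported matrices\<close>

instantiation qmat :: (type) real_algebra
begin

lift_definition zero_qmat :: "'a qmat" is "\<lambda>_ _. 0" by auto

lift_definition plus_qmat :: "'a qmat \<Rightarrow> 'a qmat \<Rightarrow> 'a qmat" is "\<lambda>f g i j. f i j + g i j"
proof -
  fix f g :: "'a \<Rightarrow> 'a \<Rightarrow> quat"
  assume "\<exists>B. finite B \<and> (\<forall>i j. f i j \<noteq> 0 \<longrightarrow> i \<in> B \<and> j \<in> B)"
    and "\<exists>B. finite B \<and> (\<forall>i j. g i j \<noteq> 0 \<longrightarrow> i \<in> B \<and> j \<in> B)"
  then obtain B C where "finite B" "\<forall>i j. f i j \<noteq> 0 \<longrightarrow> i \<in> B \<and> j \<in> B"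
    and "finite C" "\<forall>i j. g i j \<noteq> 0 \<longrightarrow> i \<in> C \<and> j \<in> C" by blast
  then show "\<exists>B. finite B \<and> (\<forall>i j. f i j + g i j \<noteq> 0 \<longrightarrow> i \<in> B \<and> j \<in> B)"
    by (intro exI[of _ "B \<union> C"]) (metis UnCI add_0 finite_UnI)
qed

lift_definition uminus_qmat :: "'a qmat \<Rightarrow> 'a qmat" is "\<lambda>f i j. - f i j" by auto

definition minus_qmat :: "'a qmat \<Rightarrow> 'a qmat \<Rightarrow> 'a qmat" where "(x :: 'a qmat) - y = x + - y"

lift_definition scaleR_qmat :: "real \<Rightarrow> 'a qmat \<Rightarrow> 'a qmat" is "\<lambda>r f i j. r *\<^sub>R f i j"
  by (metis scaleR_zero_right)

lift_definition times_qmat :: "'a qmat \<Rightarrow> 'a qmat \<Rightarrow> 'a qmat" is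
  "\<lambda>f g i k. \<Sum>j | f i j \<noteq> 0. f i j * g j k"
proof -
  fix f g :: "'a \<Rightarrow> 'a \<Rightarrow> quat"
  assume "\<exists>B. finite B \<and> (\<forall>i j. f i j \<noteq> 0 \<longrightarrow> i \<in> B \<and> j \<in> B)"
    and "\<exists>B. finite B \<and> (\<forall>i j. g i j \<noteq> 0 \<longrightarrow> i \<in> B \<and> j \<in> B)"
  then obtain B C where BC: "finite B" "\<forall>i j. f i j \<noteq> 0 \<longrightarrow> i \<in> B \<and> j \<in> B"
    "finite C" "\<forall>i j. g i j \<noteq> 0 \<longrightarrow> i \<in> C \<and> j \<in> C" by blast
  have "i \<in> B \<and> k \<in> C" if "(\<Sum>j | f i j \<noteq> 0. f i j * g j k) \<noteq> 0" for i k
  proof -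
    from sum.not_neutral_contains_not_neutral[OF that] obtain j where "f i j * g j k \<noteq> 0" by blast
    then have "f i j \<noteq> 0" "g j k \<noteq> 0" by auto
    with BC show ?thesis by blast
  qed
  then show "\<exists>B. finite B \<and> (\<forall>i k. (\<Sum>j | f i j \<noteq> 0. f i j * g j k) \<noteq> 0 \<longrightarrow> i \<in> B \<and> k \<in> B)"
    using BC by (intro exI[of _ "B \<union> C"]) blast
qed

lemma entry_simps [simp]:
  "entry 0 i j = 0" "entry (x + y) i j = entry x i j + entry y i j" "entry (- x) i j = - entry x i j"
  "entry (x - y) i j = entry x i j - entry y i j" "entry (r *\<^sub>R x) i j = r *\<^sub>R entry x i j"
  unfolding minus_qmat_def by (transfer; simp)+

text \<open>The product sums over the support of a row, which avoids choosing a bounding set; here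
  any finite set containing that support may replace it.\<close>

lemma entry_mult_left:
  assumes "finite B" "\<And>j. entry x i j \<noteq> 0 \<Longrightarrow> j \<in> B"
  shows "entry (x * y) i k = (\<Sum>j\<in>B. entry x i j * entry y j k)"
proof -
  have "entry (x * y) i k = (\<Sum>j | entry x i j \<noteq> 0. entry x i j * entry y j k)"
    by transfer simp
  also have "\<dots> = (\<Sum>j\<in>B. entry x i j * entry y j k)"
    using assms by (intro sum.mono_neutral_left) auto
  finally show ?thesis .
qed

lemma entry_mult:
  assumes "finite B" "supported B x"
  shows "entry (x * y) i k = (\<Sum>j\<in>B. entry x i j * entry y j k)"
  using assms by (intro entry_mult_left) (auto simp: supported_def)

lemma supported_mult:
  assumes "finite B" "supported B x" "supported B y"
  shows "supported B (x * y)"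
  unfolding supported_def
proof (intro allI impI)
  fix i k assume "entry (x * y) i k \<noteq> 0"
  then have "(\<Sum>j\<in>B. entry x i j * entry y j k) \<noteq> 0"
    using assms by (simp add: entry_mult)
  from sum.not_neutral_contains_not_neutral[OF this]
  obtain j where "entry x i j * entry y j k \<noteq> 0" by blast
  then have "entry x i j \<noteq> 0" "entry y j k \<noteq> 0" by auto
  then show "i \<in> B \<and> k \<in> B" using assms by (auto simp: supported_def)
qed

instance
proof
  fix x y z :: "'a qmat" and r t :: real
  show "x + y + z = x + (y + z)" "x + y = y + x" "0 + x = x" "- x + x = 0" "x - y = x + - y"
    "r *\<^sub>R (x + y) = r *\<^sub>R x + r *\<^sub>R y" "(r + t) *\<^sub>R x = r *\<^sub>R x + t *\<^sub>R x"
    "r *\<^sub>R t *\<^sub>R x = (r * t) *\<^sub>R x" "1 *\<^sub>R x = x"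
    by (auto intro!: qmat_eqI simp: algebra_simps)
  obtain B where B: "finite B" "supported B x" "supported B y" using supported2_ex by blast
  then have B': "supported B (x + y)" "supported B (r *\<^sub>R x)"
    by (auto simp: supported_def) (metis add_0)+
  show "(x * y) * z = x * (y * z)"
  proof (rule qmat_eqI)
    fix i k
    have "entry (x * y * z) i k = (\<Sum>j\<in>B. \<Sum>l\<in>B. entry x i l * entry y l j * entry z j k)"
      using B by (simp add: entry_mult[of B] supported_mult sum_distrib_right)
    also have "\<dots> = entry (x * (y * z)) i k"
      using B by (simp add: entry_mult[of B] sum_distrib_left mult.assoc, subst sum.swap, simp)
    finally show "entry (x * y * z) i k = entry (x * (y * z)) i k" .
  qed
  show "(x + y) * z = x * z + y * z" "r *\<^sub>R x * y = r *\<^sub>R (x * y)"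
    using B B' by (auto intro!: qmat_eqI simp: entry_mult[of B] algebra_simps sum.distrib scaleR_sum_right)
  show "x * (y + z) = x * y + x * z" "x * r *\<^sub>R y = r *\<^sub>R (x * y)"
    using B by (auto intro!: qmat_eqI simp: entry_mult[of B] algebra_simps sum.distrib scaleR_sum_right)
qed

end

text \<open>The case distinction preserves finite support even if \<phi> does not fix 0; for an
  involution it disappears.\<close>

lift_definition qmat_star :: "(quat \<Rightarrow> quat) \<Rightarrow> 'i qmat \<Rightarrow> 'i qmat" is
  "\<lambda>\<phi> f i j. if f j i = 0 then 0 else \<phi> (f j i)" by auto

lemma entry_qmat_star:
  assumes "involution \<phi>"
  shows "entry (qmat_star \<phi> x) i j = \<phi> (entry x j i)"
  using involution.star_zero[OF assms] by transfer simp

lemma involution_qmat_star: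
  fixes \<phi> :: "quat \<Rightarrow> quat"
  assumes "involution \<phi>"
  shows "involution (qmat_star \<phi> :: 'i qmat \<Rightarrow> 'i qmat)"
proof
  interpret \<phi>: involution \<phi> by fact
  have \<phi>_sum: "\<phi> (sum f B) = (\<Sum>x\<in>B. \<phi> (f x))" for f and B :: "'i set"
    by (induction B rule: infinite_finite_induct) (simp_all add: \<phi>.star_simps)
  note e = entry_qmat_star[OF assms]
  fix x y :: "'i qmat" and r :: real
  show "qmat_star \<phi> (x + y) = qmat_star \<phi> x + qmat_star \<phi> y"
    "qmat_star \<phi> (qmat_star \<phi> x) = x" "qmat_star \<phi> (r *\<^sub>R x) = r *\<^sub>R qmat_star \<phi> x"
    by (rule qmat_eqI; simp add: e \<phi>.star_simps)+
  obtain B where B: "finite B" "supported B x" "supported B y" using supported2_ex by blast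
  then have "supported B (qmat_star \<phi> y)"
    by (auto simp: supported_def e) (metis \<phi>.star_zero)+
  with B show "qmat_star \<phi> (x * y) = qmat_star \<phi> y * qmat_star \<phi> x"
    by (auto intro!: qmat_eqI simp: e entry_mult[of B] \<phi>_sum \<phi>.star_simps)
qed

abbreviation adj_qmat :: "'i qmat \<Rightarrow> 'i qmat" where
  "adj_qmat \<equiv> qmat_star quat_cnj"

text \<open>The real part of a diagonal entry of \<open>adj_qmat x * x\<close> is the sum of the
  squared norms of a column. The \<eta>-conjugate transpose is not proper: for \<eta> = i, the
  column with entries 1 and j gives 1 + j^2 = 0.\<close>

interpretation adj_qmat: proper_involution "adj_qmat :: 'i qmat \<Rightarrow> 'i qmat"
proof (intro proper_involution.intro proper_involution_axioms.intro)
  show "involution (adj_qmat :: 'i qmat \<Rightarrow> 'i qmat)"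
    by (intro involution_qmat_star involution_quat_cnj)
  fix x :: "'i qmat"
  assume 0: "adj_qmat x * x = 0"
  note e = entry_qmat_star[OF involution_quat_cnj]
  obtain B where B: "finite B" "supported B x" using supported_ex by blast
  then have "supported B (adj_qmat x)"
    by (auto simp: supported_def e quat_cnj_def zero_quat_def quat_eq_iff)
  show "x = 0"
  proof (rule qmat_eqI)
    fix i j
    have "(\<Sum>l\<in>B. quat_cnj (entry x l j) * entry x l j) = 0"
      using arg_cong[OF 0, of "\<lambda>x. entry x j j"] B \<open>supported B (adj_qmat x)\<close>
      by (simp add: entry_mult[of B] e)
    then have "(\<Sum>l\<in>B. (re (entry x l j))\<^sup>2 + (im1 (entry x l j))\<^sup>2
        + (im2 (entry x l j))\<^sup>2 + (im3 (entry x l j))\<^sup>2) = 0"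
      by (metis (no_types, lifting) re_cnj_mult re_sum quat_sel(1) sum.cong)
    then have "\<forall>l\<in>B. (re (entry x l j))\<^sup>2 + (im1 (entry x l j))\<^sup>2
        + (im2 (entry x l j))\<^sup>2 + (im3 (entry x l j))\<^sup>2 = 0"
      using B(1) by (subst (asm) sum_nonneg_eq_0_iff) auto
    then have "entry x i j = 0" if "i \<in> B"
      using that by (auto simp: quat_eq_iff add_nonneg_eq_0_iff)
    then show "entry x i j = entry 0 i j"
      using B(2) by (auto simp: supported_def)
  qed
qed

section \<open>Matrix units and finite dimension\<close>

lift_definition qmat_single :: "'i \<Rightarrow> 'i \<Rightarrow> quat \<Rightarrow> 'i qmat" is
  "\<lambda>k l q i j. if i = k \<and> j = l then q else 0"
  subgoal for k l by (rule exI[of _ "{k, l}"]) auto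
  done

lemma entry_sum: "entry (sum f A) i j = (\<Sum>x\<in>A. entry (f x) i j)"
  by (induction A rule: infinite_finite_induct) simp_all

lemma supported_span:
  assumes "finite B"
  shows "\<exists>T. finite T \<and> (\<forall>x :: 'i qmat. supported B x \<longrightarrow> x \<in> span T)"
proof -
  define T :: "'i qmat set" where
    "T = (\<lambda>(k, l, q). qmat_single k l q) ` (B \<times> B \<times> {1, \<i>\<^sub>q, \<j>\<^sub>q, \<k>\<^sub>q})"
  have in_span: "qmat_single k l q \<in> span T" if "k \<in> B" "l \<in> B" for k l q
  proof -
    have "qmat_single k l q = re q *\<^sub>R qmat_single k l 1 + im1 q *\<^sub>R qmat_single k l \<i>\<^sub>q
      + im2 q *\<^sub>R qmat_single k l \<j>\<^sub>q + im3 q *\<^sub>R qmat_single k l \<k>\<^sub>q"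
      by (rule qmat_eqI) (simp add: qmat_single.rep_eq flip: quat_expand)
    moreover have "qmat_single k l u \<in> T" if "u \<in> {1, \<i>\<^sub>q, \<j>\<^sub>q, \<k>\<^sub>q}" for u
      using that \<open>k \<in> B\<close> \<open>l \<in> B\<close> by (force simp: T_def)
    ultimately show ?thesis
      by (metis (no_types, lifting) insertI1 insertI2 span_add span_base span_scale)
  qed
  have "x \<in> span T" if "supported B x" for x
  proof -
    have "x = (\<Sum>k\<in>B. \<Sum>l\<in>B. qmat_single k l (entry x k l))"
    proof (rule qmat_eqI)
      fix i j
      have "(\<Sum>k\<in>B. \<Sum>l\<in>B. if i = k \<and> j = l then entry x k l else 0)
        = (\<Sum>k\<in>B. if i = k then if j \<in> B then entry x k j else 0 else 0)"
        using assms by (intro sum.cong) (auto simp: sum.delta)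
      also have "\<dots> = entry x i j"
        using assms that by (auto simp: sum.delta supported_def)
      finally show "entry x i j = entry (\<Sum>k\<in>B. \<Sum>l\<in>B. qmat_single k l (entry x k l)) i j"
        by (simp add: entry_sum qmat_single.rep_eq)
    qed
    then show ?thesis using in_span by (metis (no_types, lifting) span_sum)
  qed
  moreover have "finite T" using assms by (simp add: T_def)
  ultimately show ?thesis by blast
qed

text \<open>All powers of \<open>h\<close> are supported where \<open>h\<close> is, hence lie in one
  finite-dimensional real space.\<close>

lemma qmat_mp_exists: "\<exists>x. adj_qmat.is_mp a x"
proof -
  define h where "h = adj_qmat a * a"
  obtain B where B: "finite B" "supported B h" using supported_ex by blast
  obtain T where T: "finite T" "\<And>x. supported B x \<Longrightarrow> x \<in> span T"
    using supported_span[OF B(1)] by blast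
  have "supported B (((*) h ^^ n) h)" for n
    by (induction n) (simp_all add: B supported_mult)
  with T show ?thesis
    by (intro adj_qmat.is_mp_exists[of T]) (simp_all flip: h_def)
qed

section \<open>Tensors as matrices\<close>

lemma finite_indices: "finite (indices ds)"
proof (induction ds)
  case (Cons d ds)
  have "indices (d # ds) \<subseteq> (\<lambda>(x, xs). x # xs) ` ({..<d} \<times> indices ds)"
    by (auto simp: indices_def list_all2_Cons2 image_iff)
  then show ?case by (rule finite_subset) (use Cons in simp)
qed (simp add: indices_def)

lemma length_indices: "xs \<in> indices ds \<Longrightarrow> length xs = length ds"
  by (simp add: indices_def list_all2_lengthD)

lemma append_in_indices:
  assumes "length xs = length I \<or> length ys = length J"
  shows "xs @ ys \<in> indices (I @ J) \<longleftrightarrow> xs \<in> indices I \<and> ys \<in> indices J"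
proof (cases "length xs = length I")
  case True
  then show ?thesis by (simp add: indices_def list_all2_append)
next
  case False
  then have "xs @ ys \<notin> indices (I @ J)" "xs \<notin> indices I"
    using assms length_indices by fastforce+
  then show ?thesis by blast
qed

lift_definition mat_of :: "nat list \<Rightarrow> nat list \<Rightarrow> tensor \<Rightarrow> nat list qmat" is
  "\<lambda>I J A i j. if i \<in> indices I \<and> j \<in> indices J then A (i @ j) else 0"
  subgoal for I J by (rule exI[of _ "indices I \<union> indices J"]) (auto simp: finite_indices)
  done

text \<open>A relation rather than a map: its introduction rules follow the structure of a tensor
  term, so they check all sizes and produce the matrix form of the long formulas together.\<close>

definition represents :: "nat \<Rightarrow> nat list \<Rightarrow> nat list \<Rightarrow> tensor \<Rightarrow> nat list qmat \<Rightarrow> bool" where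
  "represents N I J A a \<longleftrightarrow>
     length I = N \<and> length J = N \<and> A \<in> tensors (I @ J) \<and> a = mat_of I J A"

abbreviation unit_qmat :: "nat list \<Rightarrow> nat list qmat" where
  "unit_qmat I \<equiv> mat_of I I (unit_tensor I)"

lemma representsD:
  assumes "represents N I J A a"
  shows "length I = N" "length J = N" "A \<in> tensors (I @ J)" "a = mat_of I J A"
    "xs \<notin> indices (I @ J) \<Longrightarrow> A xs = 0"
    "entry a i j = (if i \<in> indices I \<and> j \<in> indices J then A (i @ j) else 0)"
  using assms by (auto simp: represents_def tensors_def mat_of.rep_eq)

lemma representsI:
  assumes "length I = N" "length J = N" "\<And>xs. xs \<notin> indices (I @ J) \<Longrightarrow> A xs = 0"
    and "\<And>i j. entry a i j = (if i \<in> indices I \<and> j \<in> indices J then A (i @ j) else 0)"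
  shows "represents N I J A a"
  using assms by (auto simp: represents_def tensors_def mat_of.rep_eq intro!: qmat_eqI)

lemma represents_mat_of:
  "length I = N \<Longrightarrow> length J = N \<Longrightarrow> A \<in> tensors (I @ J) \<Longrightarrow> represents N I J A (mat_of I J A)"
  by (simp add: represents_def)

lemma represents_inject:
  assumes "represents N I J A a" "represents N I J B b"
  shows "A = B \<longleftrightarrow> a = b"
proof
  assume "a = b"
  note A = representsD[OF assms(1)] and B = representsD[OF assms(2)]
  show "A = B"
  proof
    fix xs
    show "A xs = B xs"
    proof (cases "xs \<in> indices (I @ J)")
      case True
      define i j where "i = take N xs" and "j = drop N xs"
      have "xs = i @ j" "length i = length I"
        using length_indices[OF True] A(1) by (auto simp: i_def j_def)
      with True have "i \<in> indices I" "j \<in> indices J"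
        by (simp_all add: append_in_indices)
      then have "A (i @ j) = entry a i j" "B (i @ j) = entry b i j"
        by (simp_all add: A(6) B(6))
      then show ?thesis using \<open>xs = i @ j\<close> \<open>a = b\<close> by simp
    next
      case False
      then show ?thesis using A(5) B(5) by simp
    qed
  qed
qed (use assms in \<open>simp add: represents_def\<close>)

lemma represents_zero: "length I = N \<Longrightarrow> length J = N \<Longrightarrow> represents N I J 0 0"
  by (rule representsI) auto

lemma represents_add:
  assumes "represents N I J A a" "represents N I J B b"
  shows "represents N I J (A + B) (a + b)"
  using assms[THEN representsD(1)] assms[THEN representsD(2)]
  by (auto intro!: representsI simp: assms[THEN representsD(5)] assms[THEN representsD(6)])

lemma represents_diff:
  assumes "represents N I J A a" "represents N I J B b"
  shows "represents N I J (A - B) (a - b)"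
  using assms[THEN representsD(1)] assms[THEN representsD(2)]
  by (auto intro!: representsI simp: assms[THEN representsD(5)] assms[THEN representsD(6)])

lemma represents_half:
  assumes "represents N I J A a"
  shows "represents N I J (half_tensor A) ((1/2) *\<^sub>R a)"
  using representsD(1,2)[OF assms]
  by (auto intro!: representsI simp: half_tensor_def representsD(5,6)[OF assms])

lemma represents_unit: "length I = N \<Longrightarrow> represents N I I (unit_tensor I) (unit_qmat I)"
  by (auto simp: represents_def tensors_def unit_tensor_def append_in_indices length_indices)

lemma represents_einstein:
  assumes "represents N I J A a" "represents N J K B b"
  shows "represents N I K (A \<star>\<^bsub>J\<^esub> B) (a * b)"
proof (rule representsI)
  note A = representsD[OF assms(1)] and B = representsD[OF assms(2)]
  show "length I = N" "length K = N" by (fact A(1), fact B(2))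
  show "(A \<star>\<^bsub>J\<^esub> B) xs = 0" if xs: "xs \<notin> indices (I @ K)" for xs
  proof -
    have "A (take N xs @ js) * B (js @ drop N xs) = 0" if js: "js \<in> indices J" for js
    proof (rule ccontr)
      assume "\<not> ?thesis"
      then have "take N xs @ js \<in> indices (I @ J)" "js @ drop N xs \<in> indices (J @ K)"
        using A(5) B(5) by (metis mult_zero_left, metis mult_zero_right)
      then have "take N xs \<in> indices I" "drop N xs \<in> indices K"
        using js by (simp_all add: append_in_indices length_indices)
      then have "take N xs @ drop N xs \<in> indices (I @ K)"
        using append_in_indices length_indices by blast
      then show False using xs by simp
    qed
    then show ?thesis by (simp add: einstein_def A(2))
  qed
  fix i k
  have "entry (a * b) i k = (\<Sum>j\<in>indices J. entry a i j * entry b j k)"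
    by (rule entry_mult_left) (auto simp: finite_indices A(6) split: if_splits)
  then show "entry (a * b) i k
    = (if i \<in> indices I \<and> k \<in> indices K then (A \<star>\<^bsub>J\<^esub> B) (i @ k) else 0)"
    by (auto simp: A(6) B(6) einstein_def A(1,2) length_indices intro!: sum.cong)
qed

lemma represents_star:
  assumes "involution \<phi>" "represents N I J A a"
  shows "represents N J I (\<lambda>xs. \<phi> (A (drop N xs @ take N xs))) (qmat_star \<phi> a)"
proof (rule representsI)
  note A = representsD[OF assms(2)] and zero = involution.star_zero[OF assms(1)]
  show "length J = N" "length I = N" by (fact A(2), fact A(1))
  show "\<phi> (A (drop N xs @ take N xs)) = 0" if xs: "xs \<notin> indices (J @ I)" for xs
  proof -
    have "drop N xs @ take N xs \<notin> indices (I @ J)"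
    proof
      assume *: "drop N xs @ take N xs \<in> indices (I @ J)"
      then have len: "length xs = N + N" using length_indices[OF *] A(1,2) by simp
      then have "take N xs @ drop N xs \<in> indices (J @ I)"
        using * A(1,2) by (simp add: append_in_indices del: append_take_drop_id)
      then show False using xs by simp
    qed
    then show ?thesis using A(5) zero by simp
  qed
  show "entry (qmat_star \<phi> a) j i
    = (if j \<in> indices J \<and> i \<in> indices I then \<phi> (A (drop N (j @ i) @ take N (j @ i))) else 0)" for j i
    by (auto simp: entry_qmat_star[OF assms(1)] A(6) zero length_indices A(2))
qed

lemma represents_ctranspose:
  "represents N I J A a \<Longrightarrow> represents N J I (ctranspose N A) (adj_qmat a)"
  using represents_star[OF involution_quat_cnj] by (simp add: ctranspose_def)

definition eta_qmat :: "quat \<Rightarrow> 'i qmat \<Rightarrow> 'i qmat" where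
  "eta_qmat \<eta> = qmat_star (\<lambda>q. - (\<eta> * quat_cnj q * \<eta>))"

lemma represents_eta_star:
  assumes "\<eta> \<in> {\<i>\<^sub>q, \<j>\<^sub>q, \<k>\<^sub>q}" "represents N I J A a"
  shows "represents N J I (eta_star \<eta> N A) (eta_qmat \<eta> a)"
  using represents_star[OF involution_eta[OF assms(1)] assms(2)]
  by (simp add: eta_star_def ctranspose_def eta_qmat_def)

lemma entry_unit_qmat: "entry (unit_qmat I) i j = (if i \<in> indices I \<and> i = j then 1 else 0)"
proof -
  have "(\<exists>is\<in>indices I. i @ j = is @ is) \<longleftrightarrow> i = j" if "i \<in> indices I" "j \<in> indices I"
    using that by (auto simp: append_eq_append_conv length_indices)
  then show ?thesis by (auto simp: mat_of.rep_eq unit_tensor_def)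
qed

lemma represents_unit_left:
  assumes "represents N I J A a"
  shows "unit_qmat I * a = a"
proof (rule qmat_eqI)
  fix i j
  have "entry (unit_qmat I * a) i j = (\<Sum>l\<in>indices I. entry (unit_qmat I) i l * entry a l j)"
    by (rule entry_mult_left) (auto simp: finite_indices entry_unit_qmat split: if_splits)
  also have "\<dots> = (\<Sum>l\<in>indices I. if l = i then entry a l j else 0)"
    by (rule sum.cong) (auto simp: entry_unit_qmat)
  also have "\<dots> = entry a i j"
    using representsD(6)[OF assms] by (simp add: finite_indices sum.delta)
  finally show "entry (unit_qmat I * a) i j = entry a i j" .
qed

lemma unit_qmat_star:
  assumes "involution \<phi>" "\<phi> 1 = 1"
  shows "qmat_star \<phi> (unit_qmat I) = unit_qmat I"
  using involution.star_zero[OF assms(1)] assms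
  by (auto intro!: qmat_eqI simp: entry_qmat_star entry_unit_qmat)

lemma adj_unit_qmat: "adj_qmat (unit_qmat I) = unit_qmat I"
  by (rule unit_qmat_star[OF involution_quat_cnj]) (simp add: quat_cnj_def one_quat_def)

lemma eta_unit_qmat: "\<eta> \<in> {\<i>\<^sub>q, \<j>\<^sub>q, \<k>\<^sub>q} \<Longrightarrow> eta_qmat \<eta> (unit_qmat I) = unit_qmat I"
  unfolding eta_qmat_def
  by (rule unit_qmat_star[OF involution_eta])
    (auto simp: quat_cnj_def one_quat_def quat_i_def quat_j_def quat_k_def times_quat_def uminus_quat_def)

lemma represents_unit_right:
  assumes "represents N I J A a"
  shows "a * unit_qmat J = a"
proof -
  have "adj_qmat (a * unit_qmat J) = adj_qmat a"
    using represents_unit_left[OF represents_ctranspose[OF assms]]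
    by (simp add: adj_qmat.star_mult adj_unit_qmat)
  then show ?thesis by (metis adj_qmat.star_star)
qed

text \<open>Absorbing the two unit matrices confines the support to the right block. The column
  bound is the row bound for the adjoint.\<close>

lemma represents_ex:
  assumes "length I = N" "length J = N" "unit_qmat I * a = a" "a * unit_qmat J = a"
  shows "\<exists>A. represents N I J A a"
proof -
  have row: "i \<in> indices K" if "unit_qmat K * x = x" "entry x i j \<noteq> 0" for K x i j
  proof (rule ccontr)
    assume "i \<notin> indices K"
    \<comment> \<open>Row \<open>i\<close> of the unit matrix is zero, so the empty set bounds its
      support.\<close>
    then have "entry (unit_qmat K * x) i j = (\<Sum>l\<in>{}. entry (unit_qmat K) i l * entry x l j)"
      by (intro entry_mult_left) (auto simp: entry_unit_qmat)
    then show False using that by simp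
  qed
  have col: "j \<in> indices J" if "entry a i j \<noteq> 0" for i j
  proof (rule row)
    show "unit_qmat J * adj_qmat a = adj_qmat a"
      using assms(4) by (metis adj_qmat.star_mult adj_unit_qmat)
    show "entry (adj_qmat a) j i \<noteq> 0"
      using that by (auto simp: entry_qmat_star[OF involution_quat_cnj] quat_cnj_def quat_eq_iff zero_quat_def)
  qed
  define A where "A xs = (if xs \<in> indices (I @ J) then entry a (take N xs) (drop N xs) else 0)" for xs
  have "represents N I J A a"
    by (rule representsI)
      (use assms(1,2) row[OF assms(3)] col in \<open>auto simp: A_def append_in_indices length_indices\<close>)
  then show ?thesis by blast
qed

text \<open>Absorption shows that the matrix inverse \<open>x\<close> has the transposed size, so it
  comes from a tensor. The axioms transfer along \<open>represents\<close>, and uniqueness among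
  matrices settles the definite description.\<close>

lemma represents_mp_inverse:
  assumes A: "represents N I J A a" and x: "adj_qmat.is_mp a x"
  shows "represents N J I (mp_inverse I J A) x"
proof -
  have len: "length I = N" "length J = N" using representsD[OF A] by auto
  have "unit_qmat J * adj_qmat a = adj_qmat a" "adj_qmat a * unit_qmat I = adj_qmat a"
    using represents_ctranspose[OF A] by (auto dest: represents_unit_left represents_unit_right)
  then have "unit_qmat J * x = x" "x * unit_qmat I = x"
    using adj_qmat.is_mp_absorb_left[OF x] adj_qmat.is_mp_absorb_right[OF x] by auto
  then obtain X where X: "represents N J I X x"
    using represents_ex len by metis
  have iff: "is_mp_inverse I J A Y \<longleftrightarrow> adj_qmat.is_mp a y" if Y: "represents N J I Y y" for Y y
  proof -
    note AY = represents_einstein[OF A Y] and YA = represents_einstein[OF Y A]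
    show ?thesis
      unfolding is_mp_inverse_def adj_qmat.is_mp_def len
      using representsD(3)[OF Y] represents_inject[OF represents_einstein[OF AY A] A]
        represents_inject[OF represents_einstein[OF YA Y] Y]
        represents_inject[OF represents_ctranspose[OF AY] AY]
        represents_inject[OF represents_ctranspose[OF YA] YA]
      by simp
  qed
  have "mp_inverse I J A = X"
    unfolding mp_inverse_def
  proof (rule the_equality)
    show "is_mp_inverse I J A X" using iff[OF X] x by simp
    fix Y assume Y: "is_mp_inverse I J A Y"
    then have rY: "represents N J I Y (mat_of J I Y)"
      using len by (intro represents_mat_of) (auto simp: is_mp_inverse_def)
    have "mat_of J I Y = x"
      using iff[OF rY] Y x adj_qmat.is_mp_unique by blast
    then show "Y = X" using represents_inject[OF rY X] by simp
  qed
  with X show ?thesis by simp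
qed

section \<open>The tensor equation\<close>

theorem theorem5p4:
  fixes N :: nat and I J G :: "nat list" and \<eta> :: quat and A C E P S :: tensor
  assumes "length I = N" and "length J = N" and "length G = N"
    and "\<eta> \<in> {\<i>\<^sub>q, \<j>\<^sub>q, \<k>\<^sub>q}"
    and "A \<in> tensors (I @ J)" and "C \<in> tensors (I @ G)"
    and "E \<in> tensors (I @ I)" and "eta_hermitian \<eta> N E"
    and "P = proj_R I J A \<star>\<^bsub>I\<^esub> C"
    and "S = C \<star>\<^bsub>G\<^esub> proj_L I G P"
  shows
    "((\<exists>X Y. eta_hermitian_solution \<eta> I J G A C E X Y) \<longleftrightarrow>
        proj_R I G P \<star>\<^bsub>I\<^esub> proj_R I J A \<star>\<^bsub>I\<^esub> E = 0 \<and>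
        proj_R I J A \<star>\<^bsub>I\<^esub> E \<star>\<^bsub>I\<^esub> eta_star \<eta> N (proj_R I G C) = 0) \<and>
     ((\<exists>X Y. eta_hermitian_solution \<eta> I J G A C E X Y) \<longrightarrow>
        (\<forall>X Y. eta_hermitian_solution \<eta> I J G A C E X Y \<longleftrightarrow>
          (\<exists>U1 \<in> tensors (G @ G). \<exists>U2 \<in> tensors (G @ G). \<exists>U3 \<in> tensors (G @ G).
           \<exists>U4 \<in> tensors (J @ J). \<exists>U5 \<in> tensors (J @ J). \<exists>Xh Yh.
             Xh = mp_inverse I J A \<star>\<^bsub>I\<^esub> E \<star>\<^bsub>I\<^esub> eta_star \<eta> N (mp_inverse I J A)
                - mp_inverse I J A \<star>\<^bsub>I\<^esub> C \<star>\<^bsub>G\<^esub> mp_inverse I G P \<star>\<^bsub>I\<^esub> E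
                    \<star>\<^bsub>I\<^esub> eta_star \<eta> N (mp_inverse I J A)
                - mp_inverse I J A \<star>\<^bsub>I\<^esub> S \<star>\<^bsub>G\<^esub> mp_inverse I G C \<star>\<^bsub>I\<^esub> E
                    \<star>\<^bsub>I\<^esub> eta_star \<eta> N (mp_inverse I G P) \<star>\<^bsub>G\<^esub> eta_star \<eta> N C
                    \<star>\<^bsub>I\<^esub> eta_star \<eta> N (mp_inverse I J A)
                - mp_inverse I J A \<star>\<^bsub>I\<^esub> S \<star>\<^bsub>G\<^esub> U2 \<star>\<^bsub>G\<^esub> eta_star \<eta> N (proj_L I G P)
                    \<star>\<^bsub>G\<^esub> eta_star \<eta> N C \<star>\<^bsub>I\<^esub> eta_star \<eta> N (mp_inverse I J A)
                + proj_L I J A \<star>\<^bsub>J\<^esub> U4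
                + U5 \<star>\<^bsub>J\<^esub> eta_star \<eta> N (proj_L I J A) \<and>
             Yh = mp_inverse I G P \<star>\<^bsub>I\<^esub> E \<star>\<^bsub>I\<^esub> eta_star \<eta> N (mp_inverse I G C)
                + mp_inverse I G S \<star>\<^bsub>I\<^esub> S \<star>\<^bsub>G\<^esub> mp_inverse I G C \<star>\<^bsub>I\<^esub> E
                    \<star>\<^bsub>I\<^esub> eta_star \<eta> N (mp_inverse I G P)
                + proj_L I G P \<star>\<^bsub>G\<^esub> proj_L I G S \<star>\<^bsub>G\<^esub> U1
                + proj_L I G P \<star>\<^bsub>G\<^esub> U2 \<star>\<^bsub>G\<^esub> eta_star \<eta> N (proj_L I G P)
                + U3 \<star>\<^bsub>G\<^esub> eta_star \<eta> N (proj_L I G C) \<and>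
             X = half_tensor (Xh + eta_star \<eta> N Xh) \<and>
             Y = half_tensor (Yh + eta_star \<eta> N Yh))))"
proof -
  note [simp] = assms(1-3)
  note \<eta> = assms(4) and P = assms(9) and S = assms(10)
  let ?sig = "eta_qmat \<eta> :: nat list qmat \<Rightarrow> nat list qmat"
  let ?eI = "unit_qmat I" and ?eJ = "unit_qmat J" and ?eG = "unit_qmat G"
  interpret sig: involution ?sig
    unfolding eta_qmat_def by (intro involution_qmat_star involution_eta \<eta>)
  define a c e where "a = mat_of I J A" and "c = mat_of I G C" and "e = mat_of I I E"
  have A: "represents N I J A a" and C: "represents N I G C c" and E: "represents N I I E e"
    using assms(5-7) by (simp_all add: a_def c_def e_def represents_mat_of)
  obtain ad where ad: "adj_qmat.is_mp a ad" using qmat_mp_exists by blast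
  obtain cd where cd: "adj_qmat.is_mp c cd" using qmat_mp_exists by blast
  define ra where "ra = ?eI - a * ad"
  define p where "p = ra * c"
  obtain pd where pd: "adj_qmat.is_mp p pd" using qmat_mp_exists by blast
  define lp where "lp = ?eG - pd * p"
  define s where "s = c * lp"
  obtain sd where sd: "adj_qmat.is_mp s sd" using qmat_mp_exists by blast
  define la rc lc rp ls where "la = ?eJ - ad * a" and "rc = ?eI - c * cd" and "lc = ?eG - cd * c"
    and "rp = ?eI - p * pd" and "ls = ?eG - sd * s"

  have unit: "represents N I I (unit_tensor I) ?eI" "represents N J J (unit_tensor J) ?eJ"
    "represents N G G (unit_tensor G) ?eG"
    by (simp_all add: represents_unit)
  note mp_A = represents_mp_inverse[OF A ad] and mp_C = represents_mp_inverse[OF C cd]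
  have R_A: "represents N I I (proj_R I J A) ra"
    unfolding proj_R_def ra_def by (intro represents_diff represents_einstein unit A mp_A)
  have P: "represents N I G P p"
    unfolding P p_def by (intro represents_einstein R_A C)
  note mp_P = represents_mp_inverse[OF P pd]
  have L_P: "represents N G G (proj_L I G P) lp"
    unfolding proj_L_def lp_def by (intro represents_diff represents_einstein unit P mp_P)
  have S: "represents N I G S s"
    unfolding S s_def by (intro represents_einstein L_P C)
  note mp_S = represents_mp_inverse[OF S sd]
  have L_A: "represents N J J (proj_L I J A) la"
    unfolding proj_L_def la_def by (intro represents_diff represents_einstein unit A mp_A)
  have R_C: "represents N I I (proj_R I G C) rc"
    unfolding proj_R_def rc_def by (intro represents_diff represents_einstein unit C mp_C)
  have L_C: "represents N G G (proj_L I G C) lc"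
    unfolding proj_L_def lc_def by (intro represents_diff represents_einstein unit C mp_C)
  have R_P: "represents N I I (proj_R I G P) rp"
    unfolding proj_R_def rp_def by (intro represents_diff represents_einstein unit P mp_P)
  have L_S: "represents N G G (proj_L I G S) ls"
    unfolding proj_L_def ls_def by (intro represents_diff represents_einstein unit S mp_S)
  note reps = A C E P S mp_A mp_C mp_P mp_S R_A R_C R_P L_A L_C L_P L_S
  note rep_intros = represents_add represents_diff represents_half represents_einstein
    represents_eta_star[OF \<eta>]

  have sig_e: "?sig e = e"
    using assms(8) represents_inject[OF E represents_eta_star[OF \<eta> E]]
    by (simp add: eta_hermitian_def)
  interpret hermitian_equation adj_qmat ?sig ?eI ?eJ ?eG a c e ad cd p pd s sd la ra lc rc lp rp ls
    by unfold_locales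
      (rule adj_unit_qmat eta_unit_qmat[OF \<eta>] sig_e ad cd pd sd
        reps[THEN represents_unit_left] reps[THEN represents_unit_right]
        unit[THEN represents_unit_left]
        la_def ra_def lc_def rc_def lp_def rp_def ls_def p_def s_def)+

  have cond: "proj_R I G P \<star>\<^bsub>I\<^esub> proj_R I J A \<star>\<^bsub>I\<^esub> E = 0 \<longleftrightarrow> rp * ra * e = 0"
    "proj_R I J A \<star>\<^bsub>I\<^esub> E \<star>\<^bsub>I\<^esub> eta_star \<eta> N (proj_R I G C) = 0 \<longleftrightarrow> ra * e * ?sig rc = 0"
    by (intro represents_inject[of N I I] represents_zero rep_intros reps; simp)+
  have sol: "eta_hermitian_solution \<eta> I J G A C E X Y \<longleftrightarrow> solves x y \<and> ?sig x = x \<and> ?sig y = y"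
    if X: "represents N J J X x" and Y: "represents N G G Y y" for X Y x y
  proof -
    have "A \<star>\<^bsub>J\<^esub> X \<star>\<^bsub>J\<^esub> eta_star \<eta> N A + C \<star>\<^bsub>G\<^esub> Y \<star>\<^bsub>G\<^esub> eta_star \<eta> N C = E
      \<longleftrightarrow> a * x * b + c * y * d = e"
      by (intro represents_inject[of N I I] rep_intros reps X Y)
    moreover have "eta_hermitian \<eta> N X \<longleftrightarrow> x = ?sig x" "eta_hermitian \<eta> N Y \<longleftrightarrow> y = ?sig y"
      unfolding eta_hermitian_def
      by (intro represents_inject[of N J J] rep_intros X, intro represents_inject[of N G G] rep_intros Y)
    ultimately show ?thesis
      using representsD(3)[OF X] representsD(3)[OF Y]
      by (auto simp: eta_hermitian_solution_def solves_def represents_unit_left[OF X]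
          represents_unit_left[OF Y] represents_unit_right[OF X] represents_unit_right[OF Y])
  qed

  define XH where "XH U2 U4 U5 = mp_inverse I J A \<star>\<^bsub>I\<^esub> E \<star>\<^bsub>I\<^esub> eta_star \<eta> N (mp_inverse I J A)
                - mp_inverse I J A \<star>\<^bsub>I\<^esub> C \<star>\<^bsub>G\<^esub> mp_inverse I G P \<star>\<^bsub>I\<^esub> E
                    \<star>\<^bsub>I\<^esub> eta_star \<eta> N (mp_inverse I J A)
                - mp_inverse I J A \<star>\<^bsub>I\<^esub> S \<star>\<^bsub>G\<^esub> mp_inverse I G C \<star>\<^bsub>I\<^esub> E
                    \<star>\<^bsub>I\<^esub> eta_star \<eta> N (mp_inverse I G P) \<star>\<^bsub>G\<^esub> eta_star \<eta> N C
                    \<star>\<^bsub>I\<^esub> eta_star \<eta> N (mp_inverse I J A)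
                - mp_inverse I J A \<star>\<^bsub>I\<^esub> S \<star>\<^bsub>G\<^esub> U2 \<star>\<^bsub>G\<^esub> eta_star \<eta> N (proj_L I G P)
                    \<star>\<^bsub>G\<^esub> eta_star \<eta> N C \<star>\<^bsub>I\<^esub> eta_star \<eta> N (mp_inverse I J A)
                + proj_L I J A \<star>\<^bsub>J\<^esub> U4
                + U5 \<star>\<^bsub>J\<^esub> eta_star \<eta> N (proj_L I J A)" for U2 U4 U5
  define YH where "YH U1 U2 U3 = mp_inverse I G P \<star>\<^bsub>I\<^esub> E \<star>\<^bsub>I\<^esub> eta_star \<eta> N (mp_inverse I G C)
                + mp_inverse I G S \<star>\<^bsub>I\<^esub> S \<star>\<^bsub>G\<^esub> mp_inverse I G C \<star>\<^bsub>I\<^esub> E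
                    \<star>\<^bsub>I\<^esub> eta_star \<eta> N (mp_inverse I G P)
                + proj_L I G P \<star>\<^bsub>G\<^esub> proj_L I G S \<star>\<^bsub>G\<^esub> U1
                + proj_L I G P \<star>\<^bsub>G\<^esub> U2 \<star>\<^bsub>G\<^esub> eta_star \<eta> N (proj_L I G P)
                + U3 \<star>\<^bsub>G\<^esub> eta_star \<eta> N (proj_L I G C)" for U1 U2 U3
  have XH: "represents N J J (XH U2 U4 U5) (gen_x u2 u4 u5)"
    if "represents N G G U2 u2" "represents N J J U4 u4" "represents N J J U5 u5" for U2 U4 U5 u2 u4 u5
    unfolding XH_def gen_x_def by (intro rep_intros reps that)
  have YH: "represents N G G (YH U1 U2 U3) (gen_y u1 u2 u3)"
    if "represents N G G U1 u1" "represents N G G U2 u2" "represents N G G U3 u3" for U1 U2 U3 u1 u2 u3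
    unfolding YH_def gen_y_def by (intro rep_intros reps that)
  define sym where "sym T = half_tensor (T + eta_star \<eta> N T)" for T
  have sym: "represents N K K (sym T) (symm t)" if "represents N K K T t" for K T t
    unfolding sym_def by (intro rep_intros that)

  have formula_solves: "eta_hermitian_solution \<eta> I J G A C E (sym (XH U2 U4 U5)) (sym (YH U1 U2 U3))"
    if "rp * ra * e = 0" "ra * e * ?sig rc = 0"
      and U: "U1 \<in> tensors (G @ G)" "U2 \<in> tensors (G @ G)" "U3 \<in> tensors (G @ G)"
        "U4 \<in> tensors (J @ J)" "U5 \<in> tensors (J @ J)" for U1 U2 U3 U4 U5
  proof -
    \<comment> \<open>The rotation moves the membership premise to the front, where
      \<open>THEN\<close> resolves it.\<close>
    note u = U[THEN represents_mat_of[rotated 2], of N, simplified]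
    have X: "represents N J J (sym (XH U2 U4 U5)) (symm (gen_x (mat_of G G U2) (mat_of J J U4) (mat_of J J U5)))"
      and Y: "represents N G G (sym (YH U1 U2 U3)) (symm (gen_y (mat_of G G U1) (mat_of G G U2) (mat_of G G U3)))"
      by (intro sym XH YH u)+
    show ?thesis
      unfolding sol[OF X Y] solves_def
      by (intro conjI represents_unit_left[OF X] represents_unit_left[OF Y] represents_unit_right[OF X]
          represents_unit_right[OF Y] sig_symm symm_solution general_solution that)
  qed
  have solution_formula: "\<exists>U1 \<in> tensors (G @ G). \<exists>U2 \<in> tensors (G @ G). \<exists>U3 \<in> tensors (G @ G).
      \<exists>U4 \<in> tensors (J @ J). \<exists>U5 \<in> tensors (J @ J). X = sym (XH U2 U4 U5) \<and> Y = sym (YH U1 U2 U3)"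
    and solution_cond: "rp * ra * e = 0 \<and> ra * e * ?sig rc = 0"
    if XY: "eta_hermitian_solution \<eta> I J G A C E X Y" for X Y
  proof -
    define x y where "x = mat_of J J X" and "y = mat_of G G Y"
    have X: "represents N J J X x" and Y: "represents N G G Y y"
      using XY by (simp_all add: x_def y_def eta_hermitian_solution_def represents_mat_of)
    have xy: "solves x y" "?sig x = x" "?sig y = y" using XY sol[OF X Y] by blast+
    then show "rp * ra * e = 0 \<and> ra * e * ?sig rc = 0" using necessary by blast
    let ?U2 = "mp_inverse I G S \<star>\<^bsub>I\<^esub> S \<star>\<^bsub>G\<^esub> Y" and ?U3 = "mp_inverse I G P \<star>\<^bsub>I\<^esub> P \<star>\<^bsub>G\<^esub> Y"
    let ?U4 = "X \<star>\<^bsub>J\<^esub> eta_star \<eta> N A \<star>\<^bsub>I\<^esub> eta_star \<eta> N (mp_inverse I J A)"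
    have U: "represents N G G ?U2 (sd * s * y)" "represents N G G ?U3 (pd * p * y)"
      "represents N J J ?U4 (x * b * ?sig ad)"
      by (intro rep_intros reps X Y)+
    have "represents N J J (sym (XH ?U2 ?U4 X)) (symm (gen_x (sd * s * y) (x * b * ?sig ad) x))"
      "represents N G G (sym (YH Y ?U2 ?U3)) (symm (gen_y y (sd * s * y) (pd * p * y)))"
      by (intro sym XH YH U X Y)+
    \<comment> \<open>The formulas return the solution before symmetrisation, which then changes
      nothing because \<open>x\<close> and \<open>y\<close> are fixed by \<open>sig\<close>.\<close>
    then have "sym (XH ?U2 ?U4 X) = X" "sym (YH Y ?U2 ?U3) = Y"
      unfolding solution_is_general[OF xy(1)] symm_fixed[OF xy(2)] symm_fixed[OF xy(3)]
      using represents_inject X Y by blast+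
    then show "\<exists>U1 \<in> tensors (G @ G). \<exists>U2 \<in> tensors (G @ G). \<exists>U3 \<in> tensors (G @ G).
      \<exists>U4 \<in> tensors (J @ J). \<exists>U5 \<in> tensors (J @ J). X = sym (XH U2 U4 U5) \<and> Y = sym (YH U1 U2 U3)"
      using U[THEN representsD(3)] representsD(3)[OF X] representsD(3)[OF Y] by metis
  qed

  have iff: "(\<exists>X Y. eta_hermitian_solution \<eta> I J G A C E X Y) \<longleftrightarrow> rp * ra * e = 0 \<and> ra * e * ?sig rc = 0"
  proof
    assume "rp * ra * e = 0 \<and> ra * e * ?sig rc = 0"
    \<comment> \<open>All five parameters are set to 0 to get one solution.\<close>
    moreover have "0 \<in> tensors K" for K by (simp add: tensors_def)
    ultimately show "\<exists>X Y. eta_hermitian_solution \<eta> I J G A C E X Y"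
      using formula_solves by blast
  qed (use solution_cond in blast)
  show ?thesis
    \<comment> \<open>Through \<open>iff\<close>, solvability turns into the two conditions that
      \<open>formula_solves\<close> takes as premises.\<close>
    unfolding cond iff simp_thms ex_simps XH_def[symmetric] YH_def[symmetric] sym_def[symmetric]
    using formula_solves solution_formula by blast
qed

end
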